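(* Let $(\Sigma)$: $\dot g=\mathcal X(g)+u_1B_1(g)+u_2B_2(g)$ be a two-input decoupled linear system on $\mathbb{H}^2$ such that, in some symplectic basis $(B_1,Y_1,B_2,Y_2,Z)$ of $\mathfrak h^2$, the matrix of the derivation $D$ associated to $\mathcal X$ is $$D=\begin{pmatrix}0&b&0&0&0\\1&d&0&0&0\\0&0&0&b'&0\\0&0&c'&d&0\\0&f&0&f'&d\end{pmatrix}\qquad\text{with } c'\neq 0 .$$ Assume that $(\Sigma)$ satisfies the rank condition. If none of the subsystems $(\Sigma_1)$ and $(\Sigma_2)$ is controllable, then $(\Sigma)$ is controllable if and only if $c'$ is negative.
   Context: $\mathbb{H}^2$ is the $5$-dimensional simply connected Heisenberg group of real $4\times4$ upper triangular matrices with ones on the diagonal, first row $(1,y_1,y_2,z)$, last column $(z,x_1,x_2,1)^T$, and all other off-diagonal entries $0$. Its Lie algebra $\mathfrak h^2$ (the right-invariant vector fields) has basis $X_i=\partial/\partial x_i$, $Y_i=\partial/\partial y_i+x_i\,\partial/\partial z$ $(i=1,2)$, $Z=\partial/\partial z$, with $[X_i,Y_i]=Z$ and all other brackets zero. A basis $(X_1,Y_1,X_2,Y_2,Z)$ of $\mathfrak h^2$ (with $Z$ any generator of the center) is symplectic if $[X_1,Y_1]=[X_2,Y_2]=Z$ and all other brackets of basis elements vanish. The columns of the matrix of $D$ are the coordinates of the images of the basis vectors. A vector field $\mathcal X$ on a connected Lie group $G$ is linear if its flow is a one-parameter group of automorphisms of $G$; the associated derivation of the Lie algebra $\mathfrak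 g$ (of right-invariant vector fields) is $D=-\mathrm{ad}(\mathcal X)$. A linear system is a control system $\dot g=\mathcal X(g)+\sum_{j=1}^m u_jB_j(g)$ with $\mathcal X$ linear, the $B_j$ right-invariant, and inputs $u=(u_1,\dots,u_m)$ measurable, locally bounded, with values in $\mathbb R^m$. It is controllable if for all $g,h\in G$ some input steers $g$ to $h$ in some time $T\ge 0$. It satisfies the rank condition if the Lie subalgebra of $\mathfrak g$ generated by $\{D^kB_j:\ k\in\mathbb N,\ 1\le j\le m\}$ is equal to $\mathfrak g$. Decoupled means that, for $j=1,2$, the space $\mathrm{Span}\{B_j,Y_j,Z\}$ is invariant by $D$ (which is visible on the matrix $\begin{pmatrix}0&b&0&0&0\\1&d&0&0&0\\0&0&0&b'&0\\0&0&c'&d&0\\0&f&0&f'&d\end{pmatrix}$ of $D$ in the basis $(B_1,Y_1,B_2,Y_2,Z)$). $G_j$ denotes the connected Lie subgroup of $\mathbb H^2$ with Lie algebra $\mathrm{Span}\{B_j,Y_j,Z\}$ (invariant under the flow of $\mathcal X$), and $(\Sigma_j)$ denotes the restriction of $(\Sigma)$ to $G_j$, i.e. the one-input linear system $\dot g=\mathcal X(g)+u_jB_j(g)$ on $G_j$. *)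

theory Defs
  imports
    "HOL-Analysis.Analysis"
    "HOL-Algebra.Generated_Groups"
    "HOL-Library.Function_Algebras"
begin

section \<open>Functions as a real vector space\<close>

text \<open>Addition and negation of functions come from \<^theory>\<open>HOL-Library.Function_Algebras\<close>; adding
  scalar multiplication makes \<^const>\<open>span\<close> and \<^const>\<open>independent\<close> available for vector fields.\<close>

instantiation "fun" :: (type, real_vector) real_vector
begin

definition scaleR_fun :: "real \<Rightarrow> ('a \<Rightarrow> 'b) \<Rightarrow> 'a \<Rightarrow> 'b" where
  "scaleR_fun c f = (\<lambda>x. c *\<^sub>R f x)"

instance
  by standard (simp_all add: scaleR_fun_def fun_eq_iff scaleR_add_right scaleR_add_left)

end


section \<open>The Heisenberg group of dimension 5\<close>

text \<open>An element is given by its global coordinates \<open>(x1, y1, x2, y2, z)\<close>, in the order of the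
  basis \<open>(X1, Y1, X2, Y2, Z)\<close>; \<open>heis_matrix\<close> is the matrix with these coordinates, and the
  lemma \<open>heis_matrix_mult\<close> below shows that \<open>heis_mult\<close> is the product of matrices.\<close>

type_synonym heis = "real \<times> real \<times> real \<times> real \<times> real"

fun heis_matrix :: "heis \<Rightarrow> real^4^4" where
  "heis_matrix (x1, y1, x2, y2, z) =
     vector [vector [1, y1, y2, z],
             vector [0, 1,  0,  x1],
             vector [0, 0,  1,  x2],
             vector [0, 0,  0,  1]]"

fun heis_mult :: "heis \<Rightarrow> heis \<Rightarrow> heis" where
  "heis_mult (x1, y1, x2, y2, z) (x1', y1', x2', y2', z') =
     (x1 + x1', y1 + y1', x2 + x2', y2 + y2', z + z' + y1 * x1' + y2 * x2')"

definition Heis :: "heis monoid" where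
  "Heis = \<lparr>carrier = UNIV, mult = heis_mult, one = 0\<rparr>"

lemma heis_matrix_mult: "heis_matrix (heis_mult g h) = heis_matrix g ** heis_matrix h"
  by (cases g; cases h)
     (simp add: matrix_matrix_mult_def vec_eq_iff forall_4 sum_4 vector_def)

lemma heis_matrix_one: "heis_matrix 0 = mat 1"
  by (simp add: zero_prod_def mat_def vec_eq_iff forall_4 vector_def)

lemma inj_heis_matrix: "inj heis_matrix"
proof (rule injI)
  fix g h :: heis
  assume "heis_matrix g = heis_matrix h"
  then show "g = h"
    by (cases g; cases h) (simp add: vec_eq_iff forall_4 vector_def)
qed

lemma group_Heis: "group Heis"
proof (rule groupI)
  fix g assume "g \<in> carrier Heis"
  obtain x1 y1 x2 y2 z where g: "g = (x1, y1, x2, y2, z)" by (cases g)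
  have "heis_mult (-x1, -y1, -x2, -y2, y1 * x1 + y2 * x2 - z) g = 0"
    by (simp add: g zero_prod_def)
  then show "\<exists>h\<in>carrier Heis. h \<otimes>\<^bsub>Heis\<^esub> g = \<one>\<^bsub>Heis\<^esub>"
    by (intro bexI) (simp_all add: Heis_def)
qed (auto simp: Heis_def zero_prod_def algebra_simps)


section \<open>Vector fields and the Lie algebra\<close>

type_synonym vf = "heis \<Rightarrow> heis"

text \<open>\<open>Ck k f\<close>: all iterated directional derivatives of order at most \<open>k\<close> exist and
  are continuous.\<close>

fun Ck :: "nat \<Rightarrow> vf \<Rightarrow> bool" where
  "Ck 0 f \<longleftrightarrow> continuous_on UNIV f"
| "Ck (Suc k) f \<longleftrightarrow> (\<forall>p. f differentiable (at p)) \<and>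
     (\<forall>v. Ck k (\<lambda>p. frechet_derivative f (at p) v))"

definition smooth_vf :: "vf \<Rightarrow> bool" where
  "smooth_vf V \<longleftrightarrow> (\<forall>k. Ck k V)"

definition lie_bracket :: "vf \<Rightarrow> vf \<Rightarrow> vf" where
  "lie_bracket V W =
     (\<lambda>p. frechet_derivative W (at p) (V p) - frechet_derivative V (at p) (W p))"

definition right_invariant :: "vf \<Rightarrow> bool" where
  "right_invariant V \<longleftrightarrow>
     (\<forall>g h. frechet_derivative (\<lambda>p. p \<otimes>\<^bsub>Heis\<^esub> h) (at g) (V g) = V (g \<otimes>\<^bsub>Heis\<^esub> h))"

definition heis_algebra :: "vf set" where
  "heis_algebra = {V. right_invariant V}"

lemma frechet_derivative_right_translation:
  "frechet_derivative (\<lambda>p. p \<otimes>\<^bsub>Heis\<^esub> (x1', y1', x2', y2', z')) (at g) =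
     (\<lambda>(v1, w1, v2, w2, s). (v1, w1, v2, w2, s + w1 * x1' + w2 * x2'))"
proof -
  have "(\<lambda>p. p \<otimes>\<^bsub>Heis\<^esub> (x1', y1', x2', y2', z')) =
      (\<lambda>p. (fst p + x1', fst (snd p) + y1', fst (snd (snd p)) + x2', fst (snd (snd (snd p))) + y2',
        snd (snd (snd (snd p))) + z' + fst (snd p) * x1' + fst (snd (snd (snd p))) * x2'))"
    by (auto simp: Heis_def)
  moreover have "(\<dots> has_derivative
      (\<lambda>v. (fst v, fst (snd v), fst (snd (snd v)), fst (snd (snd (snd v))),
        snd (snd (snd (snd v))) + fst (snd v) * x1' + fst (snd (snd (snd v))) * x2'))) (at g)"
    by (auto intro!: derivative_eq_intros)
  ultimately show ?thesis
    by (auto dest!: frechet_derivative_at simp: case_prod_unfold)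
qed

text \<open>The right-invariant fields are the linear combinations of \<open>\<partial>/\<partial>xi\<close>, \<open>\<partial>/\<partial>yi + xi \<partial>/\<partial>z\<close> and
  \<open>\<partial>/\<partial>z\<close>, and \<open>lie_bracket\<close> has the sign for which \<open>[Xi, Yi] = Z\<close>.\<close>

lemma heis_algebra_eq:
  "heis_algebra = {\<lambda>(x1, y1, x2, y2, z). (a1, b1, a2, b2, b1 * x1 + b2 * x2 + c) | a1 b1 a2 b2 c. True}"
proof (intro equalityI subsetI)
  fix V assume "V \<in> heis_algebra"
  then have inv: "frechet_derivative (\<lambda>p. p \<otimes>\<^bsub>Heis\<^esub> h) (at 0) (V 0) = V h" for h
  proof -
    have "0 \<otimes>\<^bsub>Heis\<^esub> h = h"
      by (cases h) (simp add: Heis_def zero_prod_def)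
    moreover have "frechet_derivative (\<lambda>p. p \<otimes>\<^bsub>Heis\<^esub> h) (at 0) (V 0) = V (0 \<otimes>\<^bsub>Heis\<^esub> h)"
      using \<open>V \<in> heis_algebra\<close> unfolding heis_algebra_def right_invariant_def by blast
    ultimately show ?thesis by (simp only:)
  qed
  obtain a1 b1 a2 b2 c where V0: "V 0 = (a1, b1, a2, b2, c)" by (cases "V 0")
  have "V = (\<lambda>(x1, y1, x2, y2, z). (a1, b1, a2, b2, b1 * x1 + b2 * x2 + c))"
  proof
    fix h :: heis
    obtain x1 y1 x2 y2 z where "h = (x1, y1, x2, y2, z)" by (cases h)
    with inv[of h] show "V h = (case h of (x1, y1, x2, y2, z) \<Rightarrow> (a1, b1, a2, b2, b1 * x1 + b2 * x2 + c))"
      by (simp add: V0 frechet_derivative_right_translation eq_commute add_ac)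
  qed
  then show "V \<in> {\<lambda>(x1, y1, x2, y2, z). (a1, b1, a2, b2, b1 * x1 + b2 * x2 + c) | a1 b1 a2 b2 c. True}"
    by blast
next
  fix V :: vf
  assume "V \<in> {\<lambda>(x1, y1, x2, y2, z). (a1, b1, a2, b2, b1 * x1 + b2 * x2 + c) | a1 b1 a2 b2 c. True}"
  then show "V \<in> heis_algebra"
    by (auto simp: heis_algebra_def right_invariant_def frechet_derivative_right_translation)
       (simp add: Heis_def algebra_simps)
qed

lemma lie_bracket_Xi_Yi:
  "lie_bracket (\<lambda>_. (1, 0, 0, 0, 0)) (\<lambda>(x1, y1, x2, y2, z). (0, 1, 0, 0, x1)) = (\<lambda>_. (0, 0, 0, 0, 1))"
  "lie_bracket (\<lambda>_. (0, 0, 1, 0, 0)) (\<lambda>(x1, y1, x2, y2, z). (0, 0, 0, 1, x2)) = (\<lambda>_. (0, 0, 0, 0, 1))"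
proof -
  have "((\<lambda>p::heis. (0::real, 1::real, 0::real, 0::real, fst p)) has_derivative (\<lambda>v. (0, 0, 0, 0, fst v))) (at p)" for p
    by (auto intro!: derivative_eq_intros)
  then have 1: "frechet_derivative (\<lambda>p::heis. (0::real, 1::real, 0::real, 0::real, fst p)) (at p) = (\<lambda>v. (0, 0, 0, 0, fst v))" for p
    by (metis frechet_derivative_at)
  have "((\<lambda>p::heis. (0::real, 0::real, 0::real, 1::real, fst (snd (snd p)))) has_derivative (\<lambda>v. (0, 0, 0, 0, fst (snd (snd v))))) (at p)" for p
    by (auto intro!: derivative_eq_intros)
  then have 2: "frechet_derivative (\<lambda>p::heis. (0::real, 0::real, 0::real, 1::real, fst (snd (snd p)))) (at p)
      = (\<lambda>v. (0, 0, 0, 0, fst (snd (snd v))))" for p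
    by (metis frechet_derivative_at)
  show "lie_bracket (\<lambda>_. (1, 0, 0, 0, 0)) (\<lambda>(x1, y1, x2, y2, z). (0, 1, 0, 0, x1)) = (\<lambda>_. (0, 0, 0, 0, 1))"
    by (simp add: lie_bracket_def case_prod_unfold 1)
  show "lie_bracket (\<lambda>_. (0, 0, 1, 0, 0)) (\<lambda>(x1, y1, x2, y2, z). (0, 0, 0, 1, x2)) = (\<lambda>_. (0, 0, 0, 0, 1))"
    by (simp add: lie_bracket_def case_prod_unfold 2)
qed

definition lie_subalgebra :: "vf set \<Rightarrow> bool" where
  "lie_subalgebra S \<longleftrightarrow> subspace S \<and> (\<forall>V\<in>S. \<forall>W\<in>S. lie_bracket V W \<in> S)"

definition generated_lie_algebra :: "vf set \<Rightarrow> vf set" where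
  "generated_lie_algebra A = lie_subalgebra hull A"

definition symplectic_basis :: "vf \<Rightarrow> vf \<Rightarrow> vf \<Rightarrow> vf \<Rightarrow> vf \<Rightarrow> bool" where
  "symplectic_basis X1 Y1 X2 Y2 Z \<longleftrightarrow>
     distinct [X1, Y1, X2, Y2, Z] \<and> independent {X1, Y1, X2, Y2, Z} \<and>
     span {X1, Y1, X2, Y2, Z} = heis_algebra \<and>
     lie_bracket X1 Y1 = Z \<and> lie_bracket X2 Y2 = Z \<and>
     lie_bracket X1 X2 = 0 \<and> lie_bracket X1 Y2 = 0 \<and>
     lie_bracket Y1 X2 = 0 \<and> lie_bracket Y1 Y2 = 0 \<and>
     (\<forall>V \<in> {X1, Y1, X2, Y2}. lie_bracket V Z = 0)"

text \<open>Column \<open>j\<close> of \<open>M\<close> (a list of rows) holds the coordinates of \<open>D (bs ! j)\<close> in \<open>bs\<close>.\<close>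

definition matrix_in_basis :: "(vf \<Rightarrow> vf) \<Rightarrow> vf list \<Rightarrow> real list list \<Rightarrow> bool" where
  "matrix_in_basis D bs M \<longleftrightarrow>
     (\<forall>j<length bs. D (bs ! j) = (\<Sum>i<length bs. (M ! i ! j) *\<^sub>R (bs ! i)))"

text \<open>The connected Lie subgroup with Lie algebra \<open>\<kk>\<close> is the subgroup generated by \<open>exp \<kk>\<close>, where
  \<open>exp V\<close> is the value at time 1 of the integral curve of \<open>V\<close> through the identity.\<close>

definition exp_image :: "vf set \<Rightarrow> heis set" where
  "exp_image \<kk> = {\<gamma> 1 | \<gamma> V. V \<in> \<kk> \<and> \<gamma> 0 = \<one>\<^bsub>Heis\<^esub> \<and>
      (\<forall>t::real. (\<gamma> has_vector_derivative V (\<gamma> t)) (at t))}"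

definition connected_lie_subgroup :: "vf set \<Rightarrow> heis set" where
  "connected_lie_subgroup \<kk> = generate Heis (exp_image \<kk>)"


section \<open>Linear systems\<close>

definition is_flow :: "(real \<Rightarrow> heis \<Rightarrow> heis) \<Rightarrow> vf \<Rightarrow> bool" where
  "is_flow \<phi> V \<longleftrightarrow>
     (\<forall>g. \<phi> 0 g = g) \<and> (\<forall>g t. ((\<lambda>s. \<phi> s g) has_vector_derivative V (\<phi> t g)) (at t))"

definition linear_vf :: "vf \<Rightarrow> bool" where
  "linear_vf \<X> \<longleftrightarrow> smooth_vf \<X> \<and>
     (\<exists>\<phi>. is_flow \<phi> \<X> \<and> (\<forall>s t. \<phi> (s + t) = \<phi> s \<circ> \<phi> t) \<and> (\<forall>t. \<phi> t \<in> iso Heis Heis))"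

definition assoc_derivation :: "vf \<Rightarrow> vf \<Rightarrow> vf" where
  "assoc_derivation \<X> V = - lie_bracket \<X> V"

definition linear_system :: "vf \<Rightarrow> vf list \<Rightarrow> bool" where
  "linear_system \<X> Bs \<longleftrightarrow> linear_vf \<X> \<and> set Bs \<subseteq> heis_algebra"

definition rank_condition :: "vf \<Rightarrow> vf list \<Rightarrow> bool" where
  "rank_condition \<X> Bs \<longleftrightarrow>
     generated_lie_algebra {(assoc_derivation \<X> ^^ k) B | k B. B \<in> set Bs} = heis_algebra"

text \<open>\<open>u j\<close> is the input multiplying the \<open>j\<close>-th controlled field.\<close>

definition admissible_input :: "nat \<Rightarrow> (nat \<Rightarrow> real \<Rightarrow> real) \<Rightarrow> bool" where
  "admissible_input m u \<longleftrightarrow>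
     (\<forall>j<m. u j \<in> borel_measurable (lebesgue_on {0..}) \<and> (\<forall>T. bounded (u j ` {0..T})))"

text \<open>Solutions are understood in the sense of Caratheodory, i.e. as solutions of the
  integrated equation.\<close>

definition trajectory ::
    "vf \<Rightarrow> vf list \<Rightarrow> (nat \<Rightarrow> real \<Rightarrow> real) \<Rightarrow> real \<Rightarrow> (real \<Rightarrow> heis) \<Rightarrow> bool" where
  "trajectory \<X> Bs u T \<gamma> \<longleftrightarrow> continuous_on {0..T} \<gamma> \<and>
     (\<forall>t\<in>{0..T}. ((\<lambda>s. \<X> (\<gamma> s) + (\<Sum>j<length Bs. u j s *\<^sub>R (Bs ! j) (\<gamma> s)))
        has_integral (\<gamma> t - \<gamma> 0)) {0..t})"

definition controllable_on :: "heis set \<Rightarrow> vf \<Rightarrow> vf list \<Rightarrow> bool" where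
  "controllable_on G \<X> Bs \<longleftrightarrow>
     (\<forall>g\<in>G. \<forall>h\<in>G. \<exists>T\<ge>0. \<exists>u \<gamma>. admissible_input (length Bs) u \<and> trajectory \<X> Bs u T \<gamma> \<and>
        \<gamma> ` {0..T} \<subseteq> G \<and> \<gamma> 0 = g \<and> \<gamma> T = h)"

definition invariant_by :: "(vf \<Rightarrow> vf) \<Rightarrow> vf set \<Rightarrow> bool" where
  "invariant_by D S \<longleftrightarrow> D ` S \<subseteq> S"

definition decoupled :: "vf \<Rightarrow> vf \<Rightarrow> vf \<Rightarrow> vf \<Rightarrow> vf \<Rightarrow> vf \<Rightarrow> bool" where
  "decoupled \<X> B1 Y1 B2 Y2 Z \<longleftrightarrow>
     invariant_by (assoc_derivation \<X>) (span {B1, Y1, Z}) \<and>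
     invariant_by (assoc_derivation \<X>) (span {B2, Y2, Z})"

end

theory Submission
  imports Defs
begin

text \<open>An automorphism of the group, which is a linear map in exponential coordinates, carries the standard
  symplectic basis to the given one. In the coordinates that it defines the system reads, with \<open>c1 = 1\<close> and \<open>c2 = c'\<close>,
  \<open>xj' = bj * yj + uj\<close>, \<open>yj' = cj * xj + d * yj\<close> for \<open>j = 1, 2\<close>, and
  \<open>z' = d * z + (c1 * x1\<^sup>2 + b1 * y1\<^sup>2 + c2 * x2\<^sup>2 + b2 * y2\<^sup>2) / 2 + f1 * y1 + f2 * y2\<close>
  (lemma \<open>controllable_normal_field\<close>). The pairs \<open>(xj, yj)\<close> can be steered at will, so the question is
  in which directions \<open>z\<close> can be moved.

  Substitute \<open>yj = exp (d * t / 2) * vj\<close>. Every smooth \<open>vj\<close> is admissible, and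
  \<open>exp (- d * t) * z + d / (4 * c1) * v1\<^sup>2 + d / (4 * c2) * v2\<^sup>2\<close> has as derivative the sum over both blocks of
  \<open>(vj'\<^sup>2 + kj * vj\<^sup>2) / (2 * cj) + exp (- d * t / 2) * fj * vj\<close>, where \<open>kj = d\<^sup>2 / 4 + bj * cj\<close>
  (lemma \<open>reachable_normal_field\<close>). Fast oscillations of \<open>v1\<close> therefore raise \<open>z\<close> by any amount
  (lemma \<open>reachable_above\<close>), and controllability only needs a way to lower it
  (lemma \<open>controllable_if_descends\<close>).

  If \<open>c' < 0\<close>, fast oscillations of \<open>v2\<close> lower \<open>z\<close>, and the system is controllable
  (lemma \<open>controllable_opposite_signs\<close>).

  Let \<open>c' > 0\<close>. If \<open>kj < 0\<close>, or if \<open>d = 0\<close> and \<open>fj \<noteq> 0\<close>, then block \<open>j\<close> alone can lower \<open>z\<close> without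
  bound and \<open>(\<Sigma>j)\<close> is controllable (lemma \<open>controllable_first_factor\<close>). Since neither subsystem is
  controllable, \<open>kj \<ge> 0\<close> for both \<open>j\<close>, and \<open>f1 = f2 = 0\<close> if \<open>d = 0\<close>. Completing squares then shows that
  \<open>W = z + d / (4 * c1) * y1\<^sup>2 + d / (4 * c2) * y2\<^sup>2 + 2 * f1 / d * y1 + 2 * f2 / d * y2\<close> (with \<open>2 * fj / d\<close> read as 0
  for \<open>d = 0\<close>) satisfies \<open>W' \<ge> d * (W - K)\<close> for a constant \<open>K\<close>, so the region \<open>W \<ge> K\<close> cannot be left and the system is not
  controllable (lemma \<open>not_controllable_normal_field\<close>).\<close>

section \<open>Product rule for indefinite integrals\<close>

lemma has_integral_increment:
  fixes f F :: "real \<Rightarrow> 'a::euclidean_space"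
  assumes f: "\<And>t. t \<in> {0..T} \<Longrightarrow> (F has_integral f t - f 0) {0..t}"
    and st: "0 \<le> s" "s \<le> t" "t \<le> T"
  shows "(F has_integral f t - f s) {s..t}"
proof -
  have t: "(F has_integral f t - f 0) {0..t}" and s: "(F has_integral f s - f 0) {0..s}"
    using f st by auto
  have "F integrable_on {s..t}"
    using st by (intro integrable_on_subinterval[OF has_integral_integrable[OF t]]) auto
  then obtain i where i: "(F has_integral i) {s..t}" by (auto simp: integrable_on_def)
  have "(F has_integral (f s - f 0) + i) {0..t}"
    using st by (intro has_integral_combine[OF _ _ s i]) auto
  with t have "f t - f 0 = f s - f 0 + i" by (rule has_integral_unique)
  with i show ?thesis by (simp add: algebra_simps)
qed

lemma norm_increment_le:
  fixes f F :: "real \<Rightarrow> 'a::euclidean_space"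
  assumes f: "\<And>t. t \<in> {0..T} \<Longrightarrow> (F has_integral f t - f 0) {0..t}"
    and st: "0 \<le> s" "s \<le> t" "t \<le> T"
    and M: "\<And>r. r \<in> {0..T} \<Longrightarrow> norm (F r) \<le> M"
  shows "norm (f t - f s) \<le> M * (t - s)"
proof -
  have "0 \<le> M" using order_trans[OF norm_ge_zero M[of s]] st by simp
  then show ?thesis
    using has_integral_bound[of M F "f t - f s" s t] has_integral_increment[OF f st] M st
    by (auto simp: cbox_interval)
qed

text \<open>A bound on increments that is quadratic in the length of the interval makes the derivative vanish
  at every point, so no almost-everywhere differentiation is involved.\<close>

lemma eq_if_increments_quadratic:
  fixes h :: "real \<Rightarrow> 'a::real_normed_vector"
  assumes h: "\<And>s t. \<lbrakk>0 \<le> s; s \<le> t; t \<le> T\<rbrakk> \<Longrightarrow> norm (h t - h s) \<le> C * (t - s)\<^sup>2"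
    and T: "0 \<le> T"
  shows "h T = h 0"
proof -
  have sym: "norm (h s - h t) \<le> C * (s - t)\<^sup>2" if "s \<in> {0..T}" "t \<in> {0..T}" for s t
    using h[of s t] h[of t s] that by (cases "s \<le> t") (auto simp: norm_minus_commute power2_commute)
  have "(h has_derivative (\<lambda>_. 0)) (at t within {0..T})" if t: "t \<in> {0..T}" for t
    unfolding has_derivative_within
  proof (intro conjI bounded_linear_zero)
    have "((\<lambda>y. \<bar>C\<bar> * \<bar>y - t\<bar>) \<longlongrightarrow> \<bar>C\<bar> * \<bar>t - t\<bar>) (at t within {0..T})"
      by (intro tendsto_intros)
    then have "((\<lambda>y. \<bar>C\<bar> * \<bar>y - t\<bar>) \<longlongrightarrow> 0) (at t within {0..T})" by simp
    moreover have "\<forall>\<^sub>F y in at t within {0..T}.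
        norm ((1 / norm (y - t)) *\<^sub>R (h y - (h t + 0))) \<le> \<bar>C\<bar> * \<bar>y - t\<bar>"
      unfolding eventually_at_filter
    proof (rule always_eventually, intro allI impI)
      fix y assume "y \<noteq> t" "y \<in> {0..T}"
      have "norm (h y - h t) \<le> C * (y - t)\<^sup>2" using sym \<open>y \<in> {0..T}\<close> t by blast
      also have "\<dots> \<le> \<bar>C\<bar> * \<bar>y - t\<bar>\<^sup>2" by (simp add: mult_right_mono)
      finally show "norm ((1 / norm (y - t)) *\<^sub>R (h y - (h t + 0))) \<le> \<bar>C\<bar> * \<bar>y - t\<bar>"
        using \<open>y \<noteq> t\<close> by (simp add: pos_divide_le_eq power2_eq_square mult.assoc)
    qed
    ultimately show "((\<lambda>y. (1 / norm (y - t)) *\<^sub>R (h y - (h t + 0))) \<longlongrightarrow> 0) (at t within {0..T})"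
      by (rule Lim_null_comparison[rotated])
  qed
  then show ?thesis
    using T by (intro has_derivative_zero_unique[of "{0..T}" h]) auto
qed

text \<open>Inputs are only measurable, so trajectories are only Lipschitz and a product of two of their
  coordinates has no derivative at some times. The product rule survives in integrated form: the
  difference between \<open>prod (f t) (g t)\<close> and the integral of the expected derivative changes by
  \<open>O((t - s)\<^sup>2)\<close> between times \<open>s\<close> and \<open>t\<close>, because \<open>F\<close> and \<open>G\<close> are bounded.\<close>

lemma has_integral_bilinear_product:
  fixes f F :: "real \<Rightarrow> 'a::euclidean_space" and g G :: "real \<Rightarrow> 'b::euclidean_space"
    and prod :: "'a \<Rightarrow> 'b \<Rightarrow> 'c::euclidean_space"
  assumes bb: "bounded_bilinear prod" and T: "0 \<le> T"
    and f: "\<And>t. t \<in> {0..T} \<Longrightarrow> (F has_integral f t - f 0) {0..t}"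
    and g: "\<And>t. t \<in> {0..T} \<Longrightarrow> (G has_integral g t - g 0) {0..t}"
    and bdd: "bounded (F ` {0..T})" "bounded (G ` {0..T})"
  shows "((\<lambda>s. prod (f s) (G s) + prod (F s) (g s)) has_integral
      prod (f T) (g T) - prod (f 0) (g 0)) {0..T}"
proof -
  interpret bounded_bilinear prod by fact
  have bilinear: "bilinear prod"
    using bb by (simp add: bilinear_conv_bounded_bilinear)
  have bilinear': "bilinear (\<lambda>x y. prod y x)"
    using flip by (simp add: bilinear_conv_bounded_bilinear)
  obtain M where M: "\<And>s. s \<in> {0..T} \<Longrightarrow> norm (F s) \<le> M" "\<And>s. s \<in> {0..T} \<Longrightarrow> norm (G s) \<le> M"
    and M0: "0 \<le> M"
  proof -
    obtain M1 M2 where "\<And>s. s \<in> {0..T} \<Longrightarrow> norm (F s) \<le> M1" "\<And>s. s \<in> {0..T} \<Longrightarrow> norm (G s) \<le> M2"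
      using bdd unfolding bounded_iff by blast
    then show ?thesis
      by (intro that[of "max 0 (max M1 M2)"]) (auto simp: le_max_iff_disj)
  qed
  obtain K where K: "0 \<le> K" "\<And>a b. norm (prod a b) \<le> norm a * norm b * K"
    using nonneg_bounded by blast
  have Tin: "T \<in> {0..T}" using T by simp
  have F_int: "F integrable_on {0..T}" and G_int: "G integrable_on {0..T}"
    using f[OF Tin] g[OF Tin] by blast+
  have F_abs: "F absolutely_integrable_on {0..T}" and G_abs: "G absolutely_integrable_on {0..T}"
    using M F_int G_int by (auto intro!: absolutely_integrable_integrable_bound[where g = "\<lambda>_. M"])
  have lipschitz: "norm (f t - f s) \<le> M * (t - s)" "norm (g t - g s) \<le> M * (t - s)"
    if "0 \<le> s" "s \<le> t" "t \<le> T" for s t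
    by (rule norm_increment_le[OF f that M(1)], assumption+)
       (rule norm_increment_le[OF g that M(2)], assumption+)
  have contf: "continuous_on {0..T} f" and contg: "continuous_on {0..T} g"
  proof -
    have eq: "f 0 + integral {0..t} F = f t" "g 0 + integral {0..t} G = g t" if "t \<in> {0..T}" for t
      using f[OF that] g[OF that] by (simp_all add: integral_unique)
    have c: "continuous_on {0..T} (\<lambda>t. f 0 + integral {0..t} F)"
        "continuous_on {0..T} (\<lambda>t. g 0 + integral {0..t} G)"
      using indefinite_integral_continuous_1[OF F_int] indefinite_integral_continuous_1[OF G_int]
      by (simp_all add: continuous_on_add)
    show "continuous_on {0..T} f" by (rule continuous_on_eq[OF c(1) eq(1)])
    show "continuous_on {0..T} g" by (rule continuous_on_eq[OF c(2) eq(2)])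
  qed
  define H where "H = (\<lambda>s. prod (f s) (G s) + prod (F s) (g s))"
  have "(\<lambda>s. prod (f s) (G s)) absolutely_integrable_on {0..T}"
    by (rule absolutely_integrable_bounded_measurable_product[OF bilinear _ _ _ G_abs])
       (auto intro!: continuous_imp_measurable_on_sets_lebesgue contf compact_imp_bounded
         compact_continuous_image)
  moreover have "(\<lambda>s. prod (F s) (g s)) absolutely_integrable_on {0..T}"
    by (rule absolutely_integrable_bounded_measurable_product[OF bilinear' _ _ _ F_abs])
       (auto intro!: continuous_imp_measurable_on_sets_lebesgue contg compact_imp_bounded
         compact_continuous_image)
  ultimately have "H absolutely_integrable_on {0..T}"
    unfolding H_def by (rule set_integral_add(1))
  then have H_int: "H integrable_on {0..T}"
    using set_lebesgue_integral_eq_integral(1) by blast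
  define h where "h = (\<lambda>t. prod (f t) (g t) - integral {0..t} H)"
  have "norm (h t - h s) \<le> (2 * K * M\<^sup>2) * (t - s)\<^sup>2" if st: "0 \<le> s" "s \<le> t" "t \<le> T" for s t
  proof -
    have H: "(H has_integral integral {0..t} H - integral {0..s} H) {s..t}"
    proof (rule has_integral_increment[of T H "\<lambda>t. integral {0..t} H", OF _ st])
      fix r assume "r \<in> {0..T}"
      then have "H integrable_on {0..r}"
        by (intro integrable_on_subinterval[OF H_int]) auto
      then show "(H has_integral integral {0..r} H - integral {0..0} H) {0..r}"
        by (simp add: integrable_integral)
    qed
    have "((\<lambda>r. prod (f t) (G r)) has_integral prod (f t) (g t - g s)) {s..t}"
      using has_integral_linear[OF has_integral_increment[OF g st] bounded_linear_right]
      by (simp add: o_def)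
    moreover have "((\<lambda>r. prod (F r) (g s)) has_integral prod (f t - f s) (g s)) {s..t}"
      using has_integral_linear[OF has_integral_increment[OF f st] bounded_linear_left]
      by (simp add: o_def)
    ultimately have "((\<lambda>r. prod (f t) (G r) + prod (F r) (g s) - H r) has_integral
        prod (f t) (g t - g s) + prod (f t - f s) (g s) - (integral {0..t} H - integral {0..s} H)) {s..t}"
      by (intro has_integral_diff has_integral_add H)
    moreover have "prod (f t) (g t - g s) + prod (f t - f s) (g s)
        - (integral {0..t} H - integral {0..s} H) = h t - h s"
      by (simp add: h_def diff_left diff_right)
    ultimately have int: "((\<lambda>r. prod (f t) (G r) + prod (F r) (g s) - H r) has_integral h t - h s) (cbox s t)"
      by simp
    have bound: "norm (prod (f t) (G r) + prod (F r) (g s) - H r) \<le> 2 * K * M\<^sup>2 * (t - s)"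
      if r: "r \<in> cbox s t" for r
    proof -
      have "norm (f t - f r) \<le> M * (t - s)"
        using lipschitz(1)[of r t] r st mult_left_mono[OF _ M0, of "t - r" "t - s"] by simp
      then have 1: "norm (prod (f t - f r) (G r)) \<le> (M * (t - s)) * M * K"
        using M(2)[of r] r st K M0
        by (auto intro!: order_trans[OF K(2)] mult_mono)
      have "norm (g r - g s) \<le> M * (t - s)"
        using lipschitz(2)[of s r] r st mult_left_mono[OF _ M0, of "r - s" "t - s"] by simp
      then have 2: "norm (prod (F r) (g r - g s)) \<le> M * (M * (t - s)) * K"
        using M(1)[of r] r st K M0
        by (auto intro!: order_trans[OF K(2)] mult_mono)
      have "prod (f t) (G r) + prod (F r) (g s) - H r = prod (f t - f r) (G r) - prod (F r) (g r - g s)"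
        by (simp add: H_def diff_left diff_right)
      also have "norm \<dots> \<le> (M * (t - s)) * M * K + M * (M * (t - s)) * K"
        by (intro order_trans[OF norm_triangle_ineq4] add_mono 1 2)
      finally show ?thesis by (simp add: power2_eq_square algebra_simps)
    qed
    have "norm (h t - h s) \<le> (2 * K * M\<^sup>2 * (t - s)) * measure lborel (cbox s t)"
      using st K M0 by (intro has_integral_bound[OF _ int bound]) auto
    then show ?thesis using st by (simp add: power2_eq_square)
  qed
  then have "h T = h 0" by (rule eq_if_increments_quadratic[OF _ T])
  then have "integral {0..T} H = prod (f T) (g T) - prod (f 0) (g 0)"
    by (simp add: h_def algebra_simps)
  with integrable_integral[OF H_int] show ?thesis by (simp add: H_def)
qed


section \<open>Trajectories under quadratic coordinate changes\<close>

definition reachable_within :: "heis set \<Rightarrow> vf \<Rightarrow> vf list \<Rightarrow> heis \<Rightarrow> heis \<Rightarrow> bool" where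
  "reachable_within G \<X> Bs g h \<longleftrightarrow>
     (\<exists>T\<ge>0. \<exists>u \<gamma>. admissible_input (length Bs) u \<and> trajectory \<X> Bs u T \<gamma> \<and>
        \<gamma> ` {0..T} \<subseteq> G \<and> \<gamma> 0 = g \<and> \<gamma> T = h)"

lemma controllable_on_iff_reachable:
  "controllable_on G \<X> Bs \<longleftrightarrow> (\<forall>g\<in>G. \<forall>h\<in>G. reachable_within G \<X> Bs g h)"
  by (simp add: controllable_on_def reachable_within_def)

lemma bounded_velocity:
  assumes adm: "admissible_input (length Bs) u" and tr: "trajectory \<X> Bs u T \<gamma>"
    and cont: "continuous_on UNIV \<X>" "\<And>B. B \<in> set Bs \<Longrightarrow> continuous_on UNIV B"
  shows "bounded ((\<lambda>s. \<X> (\<gamma> s) + (\<Sum>j<length Bs. u j s *\<^sub>R (Bs ! j) (\<gamma> s))) ` {0..T})"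
proof -
  have \<gamma>: "continuous_on {0..T} \<gamma>" using tr by (simp add: trajectory_def)
  have along: "\<exists>M. \<forall>s\<in>{0..T}. norm (V (\<gamma> s)) \<le> M" if "continuous_on UNIV V" for V :: vf
  proof -
    have "continuous_on {0..T} (\<lambda>s. V (\<gamma> s))"
      using \<gamma> that by (auto intro: continuous_on_compose2)
    then have "bounded ((\<lambda>s. V (\<gamma> s)) ` {0..T})"
      by (intro compact_imp_bounded compact_continuous_image) auto
    then show ?thesis by (simp add: bounded_iff)
  qed
  have "\<exists>M. \<forall>s\<in>{0..T}. norm (u j s *\<^sub>R (Bs ! j) (\<gamma> s)) \<le> M" if j: "j < length Bs" for j
  proof -
    obtain M1 where M1: "\<forall>s\<in>{0..T}. norm ((Bs ! j) (\<gamma> s)) \<le> M1"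
      using along cont(2) j nth_mem by blast
    obtain M2 where M2: "\<forall>s\<in>{0..T}. \<bar>u j s\<bar> \<le> M2"
      using adm j unfolding admissible_input_def bounded_iff by force
    have "norm (u j s *\<^sub>R (Bs ! j) (\<gamma> s)) \<le> \<bar>M2\<bar> * \<bar>M1\<bar>" if "s \<in> {0..T}" for s
      using M1 M2 that by (auto intro!: mult_mono intro: order_trans[OF _ abs_ge_self])
    then show ?thesis by blast
  qed
  then obtain M where M: "\<And>j s. j < length Bs \<Longrightarrow> s \<in> {0..T} \<Longrightarrow> norm (u j s *\<^sub>R (Bs ! j) (\<gamma> s)) \<le> M j"
    by metis
  obtain M0 where M0: "\<And>s. s \<in> {0..T} \<Longrightarrow> norm (\<X> (\<gamma> s)) \<le> M0"
    using along[OF cont(1)] by blast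
  have "norm (\<X> (\<gamma> s) + (\<Sum>j<length Bs. u j s *\<^sub>R (Bs ! j) (\<gamma> s))) \<le> M0 + (\<Sum>j<length Bs. M j)"
    if "s \<in> {0..T}" for s
    using that M M0 by (intro order_trans[OF norm_triangle_ineq] add_mono sum_norm_le) auto
  then show ?thesis unfolding bounded_iff by blast
qed

text \<open>Automorphisms of a two-step nilpotent group are quadratic in the coordinates, so the product rule
  is all that is needed to carry a trajectory along one: \<open>h \<mapsto> A h + \<beta> p h + \<beta> h p\<close> is the derivative
  of \<open>\<Phi>\<close> at \<open>p\<close>.\<close>

lemma trajectory_quadratic_image:
  fixes A :: "heis \<Rightarrow> heis" and \<beta> :: "heis \<Rightarrow> heis \<Rightarrow> heis"
  assumes adm: "admissible_input (length Bs) u" and tr: "trajectory \<X> Bs u T \<gamma>"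
    and cont: "continuous_on UNIV \<X>" "\<And>B. B \<in> set Bs \<Longrightarrow> continuous_on UNIV B"
    and A: "bounded_linear A" and \<beta>: "bounded_bilinear \<beta>"
    and \<Phi>: "\<And>p. \<Phi> p = A p + \<beta> p p"
    and drift: "\<And>p. A (\<X> p) + (\<beta> p (\<X> p) + \<beta> (\<X> p) p) = \<X>' (\<Phi> p)"
    and inputs: "length Bs' = length Bs"
      "\<And>j p. j < length Bs \<Longrightarrow>
         A ((Bs ! j) p) + (\<beta> p ((Bs ! j) p) + \<beta> ((Bs ! j) p) p) = (Bs' ! j) (\<Phi> p)"
  shows "trajectory \<X>' Bs' u T (\<Phi> \<circ> \<gamma>)"
proof -
  interpret A: bounded_linear A by fact
  interpret \<beta>: bounded_bilinear \<beta> by fact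
  define F where "F = (\<lambda>s. \<X> (\<gamma> s) + (\<Sum>j<length Bs. u j s *\<^sub>R (Bs ! j) (\<gamma> s)))"
  have \<gamma>: "continuous_on {0..T} \<gamma>"
    and F: "\<And>t. t \<in> {0..T} \<Longrightarrow> (F has_integral \<gamma> t - \<gamma> 0) {0..t}"
    using tr by (auto simp: trajectory_def F_def)
  have bdd: "bounded (F ` {0..T})"
    unfolding F_def by (rule bounded_velocity[OF adm tr cont])
  have chain: "A (F s) + (\<beta> (\<gamma> s) (F s) + \<beta> (F s) (\<gamma> s))
      = \<X>' (\<Phi> (\<gamma> s)) + (\<Sum>j<length Bs'. u j s *\<^sub>R (Bs' ! j) (\<Phi> (\<gamma> s)))" for s
    unfolding F_def A.add A.sum A.scaleR \<beta>.add_left \<beta>.add_right \<beta>.sum_left \<beta>.sum_right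
      \<beta>.scaleR_left \<beta>.scaleR_right inputs(1)
    by (simp add: drift[symmetric] inputs(2)[symmetric] scaleR_add_right sum.distrib
        algebra_simps del: scaleR_Pair)
  have "((\<lambda>s. A (F s) + (\<beta> (\<gamma> s) (F s) + \<beta> (F s) (\<gamma> s))) has_integral
      A (\<gamma> t - \<gamma> 0) + (\<beta> (\<gamma> t) (\<gamma> t) - \<beta> (\<gamma> 0) (\<gamma> 0))) {0..t}" if t: "t \<in> {0..T}" for t
  proof (rule has_integral_add)
    show "((\<lambda>s. A (F s)) has_integral A (\<gamma> t - \<gamma> 0)) {0..t}"
      using has_integral_linear[OF F[OF t] A] by (simp add: o_def)
    show "((\<lambda>s. \<beta> (\<gamma> s) (F s) + \<beta> (F s) (\<gamma> s)) has_integral \<beta> (\<gamma> t) (\<gamma> t) - \<beta> (\<gamma> 0) (\<gamma> 0)) {0..t}"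
      using t by (intro has_integral_bilinear_product[OF \<beta>] F bounded_subset[OF bdd] image_mono) auto
  qed
  moreover have increment: "A (\<gamma> t - \<gamma> 0) + (\<beta> (\<gamma> t) (\<gamma> t) - \<beta> (\<gamma> 0) (\<gamma> 0)) = \<Phi> (\<gamma> t) - \<Phi> (\<gamma> 0)" for t
    by (simp add: \<Phi> A.diff)
  ultimately have "((\<lambda>s. \<X>' (\<Phi> (\<gamma> s)) + (\<Sum>j<length Bs'. u j s *\<^sub>R (Bs' ! j) (\<Phi> (\<gamma> s)))) has_integral
      \<Phi> (\<gamma> t) - \<Phi> (\<gamma> 0)) {0..t}" if "t \<in> {0..T}" for t
    using that by (simp only: chain increment)
  moreover have "continuous_on {0..T} (\<Phi> \<circ> \<gamma>)"
    unfolding o_def \<Phi> by (intro continuous_intros A.continuous_on \<beta>.continuous_on \<gamma>)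
  ultimately show ?thesis by (simp add: trajectory_def)
qed

lemma borel_measurable_shift_lebesgue:
  fixes f :: "real \<Rightarrow> real"
  assumes "f \<in> borel_measurable lebesgue"
  shows "(\<lambda>x. f (x - c)) \<in> borel_measurable lebesgue"
proof -
  have "(\<lambda>x. - c + (\<Sum>j\<in>Basis. (1 * (x \<bullet> j)) *\<^sub>R j)) \<in> lebesgue \<rightarrow>\<^sub>M (lebesgue :: real measure)"
    by (rule lebesgue_affine_measurable) simp
  from measurable_comp[OF this assms] show ?thesis by (simp add: o_def)
qed

text \<open>Concatenation of trajectories. Measurability of the delayed input is that of a Lebesgue measurable
  function composed with a translation.\<close>

lemma reachable_within_trans:
  assumes "reachable_within G \<X> Bs g h" and "reachable_within G \<X> Bs h k"
  shows "reachable_within G \<X> Bs g k"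
proof -
  define F where "F = (\<lambda>u \<gamma> (s::real). \<X> (\<gamma> s) + (\<Sum>j<length Bs. u j s *\<^sub>R (Bs ! j) (\<gamma> s)))"
  obtain T1 u1 \<gamma>1 where T1: "0 \<le> T1" and adm1: "admissible_input (length Bs) u1"
    and tr1: "continuous_on {0..T1} \<gamma>1" "\<And>t. t \<in> {0..T1} \<Longrightarrow> (F u1 \<gamma>1 has_integral \<gamma>1 t - \<gamma>1 0) {0..t}"
    and path1: "\<gamma>1 ` {0..T1} \<subseteq> G" "\<gamma>1 0 = g" "\<gamma>1 T1 = h"
    using assms(1) unfolding reachable_within_def trajectory_def F_def by blast
  obtain T2 u2 \<gamma>2 where T2: "0 \<le> T2" and adm2: "admissible_input (length Bs) u2"
    and tr2: "continuous_on {0..T2} \<gamma>2" "\<And>t. t \<in> {0..T2} \<Longrightarrow> (F u2 \<gamma>2 has_integral \<gamma>2 t - \<gamma>2 0) {0..t}"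
    and path2: "\<gamma>2 ` {0..T2} \<subseteq> G" "\<gamma>2 0 = h" "\<gamma>2 T2 = k"
    using assms(2) unfolding reachable_within_def trajectory_def F_def by blast
  define u where "u = (\<lambda>j s. if s \<le> T1 then u1 j s else u2 j (s - T1))"
  define \<gamma> where "\<gamma> = (\<lambda>s. if s \<le> T1 then \<gamma>1 s else \<gamma>2 (s - T1))"
  have adm: "admissible_input (length Bs) u"
    unfolding admissible_input_def
  proof (intro allI impI conjI)
    fix j assume j: "j < length Bs"
    have a: "(\<lambda>s. if s \<in> {0..} then u1 j s else 0) \<in> borel_measurable lebesgue"
      using adm1 j by (intro borel_measurable_if_I) (auto simp: admissible_input_def)
    have b: "(\<lambda>s. if s - T1 \<in> {0..} then u2 j (s - T1) else 0) \<in> borel_measurable lebesgue"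
      using adm2 j
      by (intro borel_measurable_shift_lebesgue[of "\<lambda>s. if s \<in> {0..} then u2 j s else 0"] borel_measurable_if_I)
         (auto simp: admissible_input_def)
    have "(\<lambda>s. if s \<le> T1 then if s \<in> {0..} then u1 j s else 0 else
        if s - T1 \<in> {0..} then u2 j (s - T1) else 0) \<in> borel_measurable (lebesgue_on {0..})"
      by (intro measurable_restrict_space1 measurable_If[OF a b]) (simp flip: atMost_def)
    then show "u j \<in> borel_measurable (lebesgue_on {0..})"
      by (rule measurable_cong[THEN iffD1, rotated]) (auto simp: u_def)
    fix T
    have "u j ` {0..T} \<subseteq> u1 j ` {0..T} \<union> u2 j ` {0..T}"
    proof (rule image_subsetI)
      fix s assume "s \<in> {0..T}"
      then show "u j s \<in> u1 j ` {0..T} \<union> u2 j ` {0..T}"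
        using T1 by (cases "s \<le> T1") (simp_all add: u_def)
    qed
    moreover have "bounded (u1 j ` {0..T} \<union> u2 j ` {0..T})"
      using adm1 adm2 j by (simp add: admissible_input_def)
    ultimately show "bounded (u j ` {0..T})" by (rule bounded_subset[rotated])
  qed
  have first: "(F u \<gamma> has_integral \<gamma> t - \<gamma> 0) {0..t}" if "t \<in> {0..T1}" for t
    using tr1(2)[OF that] that T1
    by (subst has_integral_cong[of _ _ "F u1 \<gamma>1"]) (auto simp: F_def u_def \<gamma>_def)
  have "(F u \<gamma> has_integral \<gamma> t - \<gamma> 0) {0..t}" if t: "t \<in> {0..T1 + T2}" for t
  proof (cases "t \<le> T1")
    case True then show ?thesis using first that by auto
  next
    case False
    have "(F u2 \<gamma>2 has_integral \<gamma>2 (t - T1) - \<gamma>2 0) {0..t - T1}"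
      using tr2(2) t False by auto
    from has_integral_shift_real_ivl[OF this, of "- T1"]
    have "((\<lambda>s. F u2 \<gamma>2 (s - T1)) has_integral \<gamma> t - \<gamma> T1) {T1..t}"
      using False path1 path2 by (simp add: \<gamma>_def)
    \<comment> \<open>at time \<open>T1\<close> itself \<open>u\<close> still takes the value of the first input\<close>
    then have "(F u \<gamma> has_integral \<gamma> t - \<gamma> T1) {T1..t}"
      by (rule has_integral_spike_finite[of "{T1}", rotated 2]) (auto simp: F_def u_def \<gamma>_def)
    with first[of T1] T1 False have "(F u \<gamma> has_integral (\<gamma> T1 - \<gamma> 0) + (\<gamma> t - \<gamma> T1)) {0..t}"
      by (intro has_integral_combine[of 0 T1 t]) auto
    then show ?thesis by simp
  qed
  moreover have "continuous_on {0..T1 + T2} \<gamma>"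
  proof -
    have "continuous_on ({0..T1} \<union> {T1..T1 + T2}) (\<lambda>s. if s \<le> T1 then \<gamma>1 s else \<gamma>2 (s - T1))"
    proof (rule continuous_on_If)
      show "continuous_on {T1..T1 + T2} (\<lambda>s. \<gamma>2 (s - T1))"
        by (rule continuous_on_compose2[OF tr2(1)]) (auto intro!: continuous_intros)
    qed (use tr1 path1 path2 in auto)
    moreover have "{0..T1} \<union> {T1..T1 + T2} = {0..T1 + T2}" using T1 T2 by auto
    ultimately show ?thesis by (simp add: \<gamma>_def)
  qed
  ultimately have "trajectory \<X> Bs u (T1 + T2) \<gamma>"
    by (simp add: trajectory_def F_def)
  moreover have "\<gamma> ` {0..T1 + T2} \<subseteq> G"
  proof (rule image_subsetI)
    fix s assume "s \<in> {0..T1 + T2}"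
    then show "\<gamma> s \<in> G"
      using path1(1) path2(1) by (cases "s \<le> T1") (auto simp: \<gamma>_def image_subset_iff)
  qed
  moreover have "\<gamma> 0 = g" using T1 path1 by (simp add: \<gamma>_def)
  moreover have "\<gamma> (T1 + T2) = k" using T2 path1 path2 by (auto simp: \<gamma>_def)
  ultimately show ?thesis
    unfolding reachable_within_def using adm T1 T2 by (intro exI[of _ "T1 + T2"]) auto
qed

section \<open>Right-invariant and linear fields on the Heisenberg group\<close>

definition zvec :: heis where "zvec = (0, 0, 0, 0, 1)"

text \<open>The Heisenberg group is the central extension of \<open>\<real>\<^sup>4\<close> by this cocycle (lemma \<open>heis_mult_eq\<close>); its
  antisymmetrization is the symplectic form that gives the brackets.\<close>

definition cocycle :: "heis \<Rightarrow> heis \<Rightarrow> real" where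
  "cocycle g h = fst (snd g) * fst h + fst (snd (snd (snd g))) * fst (snd (snd h))"

lemma cocycle_simp [simp]:
  "cocycle (x1, y1, x2, y2, z) (x1', y1', x2', y2', z') = y1 * x1' + y2 * x2'"
  by (simp add: cocycle_def)

lemma bilinear_cocycle: "bounded_bilinear cocycle"
  unfolding cocycle_def
  by (intro bilinear_conv_bounded_bilinear[THEN iffD1])
     (auto simp: bilinear_def algebra_simps intro!: linearI)

interpretation cocycle: bounded_bilinear cocycle by (rule bilinear_cocycle)

lemma cocycle_zvec [simp]: "cocycle zvec p = 0" "cocycle p zvec = 0"
  by (simp_all add: zvec_def cocycle_def)

lemma heis_mult_eq: "heis_mult g h = g + h + cocycle g h *\<^sub>R zvec"
  by (cases g; cases h) (simp add: zvec_def)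

definition symplectic_form :: "heis \<Rightarrow> heis \<Rightarrow> real" where
  "symplectic_form v w = cocycle w v - cocycle v w"

definition right_field :: "heis \<Rightarrow> vf" where
  "right_field v = (\<lambda>p. v + cocycle v p *\<^sub>R zvec)"

text \<open>The field that is the linear map \<open>D\<close> in exponential coordinates, where \<open>p\<close> is the exponential of
  \<open>p - (cocycle p p / 2) *\<^sub>R zvec\<close>. When \<open>D\<close> is a derivation with \<open>D zvec = \<delta> *\<^sub>R zvec\<close> this is the
  linear vector field with derivation \<open>D\<close>.\<close>

definition linear_field :: "(heis \<Rightarrow> heis) \<Rightarrow> real \<Rightarrow> vf" where
  "linear_field D \<delta> = (\<lambda>p. D p +
     ((cocycle p (D p) + cocycle (D p) p - \<delta> * cocycle p p) / 2) *\<^sub>R zvec)"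

text \<open>The linear map \<open>A\<close> read in exponential coordinates: the group endomorphism with differential
  \<open>A\<close> when \<open>A\<close> multiplies the symplectic form by \<open>\<mu>\<close> and \<open>A zvec = \<mu> *\<^sub>R zvec\<close>.\<close>

definition heis_hom :: "(heis \<Rightarrow> heis) \<Rightarrow> real \<Rightarrow> heis \<Rightarrow> heis" where
  "heis_hom A \<mu> = (\<lambda>p. A p + ((cocycle (A p) (A p) - \<mu> * cocycle p p) / 2) *\<^sub>R zvec)"

text \<open>The quadratic part of \<open>heis_hom\<close>, polarized, so that
  \<open>h \<mapsto> A h + hom_bilinear A \<mu> p h + hom_bilinear A \<mu> h p\<close> is the derivative of \<open>heis_hom A \<mu>\<close> at
  \<open>p\<close>.\<close>

definition hom_bilinear :: "(heis \<Rightarrow> heis) \<Rightarrow> real \<Rightarrow> heis \<Rightarrow> heis \<Rightarrow> heis" where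
  "hom_bilinear A \<mu> p h = ((cocycle (A p) (A h) - \<mu> * cocycle p h) / 2) *\<^sub>R zvec"

lemma bounded_bilinear_hom_bilinear:
  assumes "bounded_linear A"
  shows "bounded_bilinear (hom_bilinear A \<mu>)"
proof -
  interpret A: bounded_linear A by fact
  show ?thesis
    unfolding bilinear_conv_bounded_bilinear[symmetric] bilinear_def hom_bilinear_def
    by (intro conjI allI linearI)
      (simp_all add: A.add A.scaleR cocycle.add_left cocycle.add_right
        cocycle.scaleR_left cocycle.scaleR_right algebra_simps add_divide_distrib diff_divide_distrib)
qed

lemma heis_hom_eq: "heis_hom A \<mu> p = A p + hom_bilinear A \<mu> p p"
  by (simp add: heis_hom_def hom_bilinear_def)

text \<open>Exchanging the arguments of the cocycle costs a value of the symplectic form, which \<open>A\<close> scales by the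
  same factor as the center.\<close>

lemma heis_hom_right_field:
  assumes A: "linear A" and z: "A zvec = \<mu> *\<^sub>R zvec"
    and symp: "\<And>v w. symplectic_form (A v) (A w) = \<mu> * symplectic_form v w"
  shows "A (right_field v p) + (hom_bilinear A \<mu> p (right_field v p) + hom_bilinear A \<mu> (right_field v p) p)
    = right_field (A v) (heis_hom A \<mu> p)"
proof -
  have "cocycle (A v) (A p) = cocycle (A p) (A v) + \<mu> * (cocycle v p - cocycle p v)"
    using symp[of p v] by (simp add: symplectic_form_def algebra_simps)
  then have "cocycle v p * \<mu> + ((cocycle (A p) (A v) - \<mu> * cocycle p v) / 2
      + (cocycle (A v) (A p) - \<mu> * cocycle v p) / 2) = cocycle (A v) (A p)"
    by (simp add: field_simps)
  moreover have "A (right_field v p) = A v + (cocycle v p * \<mu>) *\<^sub>R zvec"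
    by (simp add: right_field_def linear_add[OF A] linear_cmul[OF A] z)
  moreover have "hom_bilinear A \<mu> p (right_field v p) = ((cocycle (A p) (A v) - \<mu> * cocycle p v) / 2) *\<^sub>R zvec"
    "hom_bilinear A \<mu> (right_field v p) p = ((cocycle (A v) (A p) - \<mu> * cocycle v p) / 2) *\<^sub>R zvec"
    by (simp_all add: hom_bilinear_def \<open>A (right_field v p) = _\<close> cocycle.add_left cocycle.add_right
        cocycle.scaleR_left cocycle.scaleR_right)
       (simp_all add: right_field_def cocycle.add_left cocycle.add_right
        cocycle.scaleR_left cocycle.scaleR_right)
  moreover have "right_field (A v) (heis_hom A \<mu> p) = A v + cocycle (A v) (A p) *\<^sub>R zvec"
    by (simp add: right_field_def heis_hom_def cocycle.add_right cocycle.scaleR_right)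
  ultimately show ?thesis
    by (simp only: add.assoc scaleR_add_left[symmetric])
qed

text \<open>In exponential coordinates both fields and the map are linear, and the claim is \<open>D' (A p) = A (D p)\<close>.\<close>

lemma heis_hom_linear_field:
  assumes A: "linear A" and z: "A zvec = \<mu> *\<^sub>R zvec"
    and D': "linear D'" "D' zvec = \<delta> *\<^sub>R zvec" and inter: "\<And>p. D' (A p) = A (D p)"
  shows "A (linear_field D \<delta> p)
      + (hom_bilinear A \<mu> p (linear_field D \<delta> p) + hom_bilinear A \<mu> (linear_field D \<delta> p) p)
    = linear_field D' \<delta> (heis_hom A \<mu> p)"
proof -
  define k where "k = (cocycle p (D p) + cocycle (D p) p - \<delta> * cocycle p p) / 2"
  define l where "l = (cocycle (A p) (A p) - \<mu> * cocycle p p) / 2"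
  have X: "linear_field D \<delta> p = D p + k *\<^sub>R zvec" by (simp add: linear_field_def k_def)
  have AX: "A (linear_field D \<delta> p) = A (D p) + (k * \<mu>) *\<^sub>R zvec"
    by (simp add: X linear_add[OF A] linear_cmul[OF A] z)
  have \<Phi>: "heis_hom A \<mu> p = A p + l *\<^sub>R zvec" by (simp add: heis_hom_def l_def)
  have D\<Phi>: "D' (heis_hom A \<mu> p) = A (D p) + (l * \<delta>) *\<^sub>R zvec"
    by (simp add: \<Phi> linear_add[OF D'(1)] linear_cmul[OF D'(1)] D'(2) inter)
  have "hom_bilinear A \<mu> p (linear_field D \<delta> p) = ((cocycle (A p) (A (D p)) - \<mu> * cocycle p (D p)) / 2) *\<^sub>R zvec"
    by (simp add: hom_bilinear_def AX cocycle.add_right cocycle.scaleR_right)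
       (simp add: X cocycle.add_right cocycle.scaleR_right)
  moreover have "hom_bilinear A \<mu> (linear_field D \<delta> p) p = ((cocycle (A (D p)) (A p) - \<mu> * cocycle (D p) p) / 2) *\<^sub>R zvec"
    by (simp add: hom_bilinear_def AX cocycle.add_left cocycle.scaleR_left)
       (simp add: X cocycle.add_left cocycle.scaleR_left)
  moreover have "linear_field D' \<delta> (heis_hom A \<mu> p) = A (D p) + (l * \<delta> +
      (cocycle (A p) (A (D p)) + cocycle (A (D p)) (A p) - \<delta> * cocycle (A p) (A p)) / 2) *\<^sub>R zvec"
    unfolding linear_field_def D\<Phi>
    by (simp add: \<Phi> scaleR_add_left add.assoc cocycle.add_left cocycle.add_right cocycle.scaleR_left cocycle.scaleR_right)
  moreover have "k * \<mu> + ((cocycle (A p) (A (D p)) - \<mu> * cocycle p (D p)) / 2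
      + (cocycle (A (D p)) (A p) - \<mu> * cocycle (D p) p) / 2) = l * \<delta> +
      (cocycle (A p) (A (D p)) + cocycle (A (D p)) (A p) - \<delta> * cocycle (A p) (A p)) / 2"
    by (simp add: k_def l_def field_simps)
  ultimately show ?thesis
    by (simp only: AX add.assoc scaleR_add_left[symmetric])
qed

lemma heis_hom_inverse:
  assumes A: "linear A'" and z: "A' zvec = \<mu>' *\<^sub>R zvec" and inv: "\<And>p. A' (A p) = p"
    and "\<mu>' * \<mu> = 1"
  shows "heis_hom A' \<mu>' (heis_hom A \<mu> p) = p"
proof -
  define l where "l = (cocycle (A p) (A p) - \<mu> * cocycle p p) / 2"
  have \<Phi>: "heis_hom A \<mu> p = A p + l *\<^sub>R zvec" by (simp add: heis_hom_def l_def)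
  have A\<Phi>: "A' (heis_hom A \<mu> p) = p + (l * \<mu>') *\<^sub>R zvec"
    by (simp add: \<Phi> linear_add[OF A] linear_cmul[OF A] z inv)
  have "heis_hom A' \<mu>' (heis_hom A \<mu> p) = p + (l * \<mu>' + (cocycle p p - \<mu>' * cocycle (A p) (A p)) / 2) *\<^sub>R zvec"
    unfolding heis_hom_def[of A'] A\<Phi>
    by (simp add: \<Phi> scaleR_add_left add.assoc cocycle.add_left cocycle.add_right cocycle.scaleR_left cocycle.scaleR_right)
  also have "l * \<mu>' + (cocycle p p - \<mu>' * cocycle (A p) (A p)) / 2 = (1 - \<mu>' * \<mu>) * cocycle p p / 2"
    by (simp add: l_def field_simps)
  finally show ?thesis using assms(4) by simp
qed

lemma continuous_right_field: "continuous_on UNIV (right_field v)"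
  unfolding right_field_def by (intro continuous_intros cocycle.continuous_on)

lemma continuous_linear_field:
  assumes "linear D" shows "continuous_on UNIV (linear_field D \<delta>)"
  unfolding linear_field_def
  by (intro continuous_intros cocycle.continuous_on linear_continuous_on
      linear_conv_bounded_linear[THEN iffD1] assms) auto

text \<open>Used with the frame of a symplectic basis and with its inverse, this carries the problem both ways
  between that basis and the standard one.\<close>

lemma controllable_heis_hom_image:
  assumes A: "linear A" "A zvec = \<mu> *\<^sub>R zvec"
    and symp: "\<And>v w. symplectic_form (A v) (A w) = \<mu> * symplectic_form v w"
    and D: "linear D" and D': "linear D'" "D' zvec = \<delta> *\<^sub>R zvec" and inter: "\<And>p. D' (A p) = A (D p)"
    and ctrl: "controllable_on G (linear_field D \<delta>) (map right_field vs)"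
  shows "controllable_on (heis_hom A \<mu> ` G) (linear_field D' \<delta>) (map (\<lambda>v. right_field (A v)) vs)"
  unfolding controllable_on_iff_reachable
proof (intro ballI, elim imageE)
  fix g' h' g h assume eq: "g' = heis_hom A \<mu> g" "h' = heis_hom A \<mu> h" and gh: "g \<in> G" "h \<in> G"
  let ?\<Phi> = "heis_hom A \<mu>" and ?X = "linear_field D \<delta>" and ?X' = "linear_field D' \<delta>"
    and ?Bs = "map right_field vs" and ?Bs' = "map (\<lambda>v. right_field (A v)) vs"
  have bA: "bounded_linear A" using A(1) by (simp add: linear_conv_bounded_linear)
  obtain T u \<gamma> where T: "0 \<le> T" and adm: "admissible_input (length ?Bs) u"
    and tr: "trajectory ?X ?Bs u T \<gamma>" and path: "\<gamma> ` {0..T} \<subseteq> G" "\<gamma> 0 = g" "\<gamma> T = h"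
    using ctrl gh unfolding controllable_on_def by blast
  have "trajectory ?X' ?Bs' u T (?\<Phi> \<circ> \<gamma>)"
  proof (rule trajectory_quadratic_image[OF adm tr _ _ bA bounded_bilinear_hom_bilinear[OF bA]])
    show "continuous_on UNIV ?X" by (rule continuous_linear_field[OF D])
    show "continuous_on UNIV B" if "B \<in> set ?Bs" for B
      using that by (auto intro: continuous_right_field)
    show "?\<Phi> p = A p + hom_bilinear A \<mu> p p" for p by (rule heis_hom_eq)
    show "A (?X p) + (hom_bilinear A \<mu> p (?X p) + hom_bilinear A \<mu> (?X p) p) = ?X' (?\<Phi> p)" for p
      by (rule heis_hom_linear_field[OF A D' inter])
    show "length ?Bs' = length ?Bs" by simp
    show "A ((?Bs ! j) p) + (hom_bilinear A \<mu> p ((?Bs ! j) p) + hom_bilinear A \<mu> ((?Bs ! j) p) p)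
        = (?Bs' ! j) (?\<Phi> p)" if "j < length ?Bs" for j p
      using that heis_hom_right_field[OF A symp] by simp
  qed
  then show "reachable_within (?\<Phi> ` G) ?X' ?Bs' g' h'"
    unfolding reachable_within_def
    using T adm path eq
    by (intro exI[of _ T] exI[of _ u] exI[of _ "?\<Phi> \<circ> \<gamma>"] conjI) auto
qed

section \<open>Recovering a linear field from its derivation\<close>

lemma heis_algebra_eq_range: "heis_algebra = range right_field"
proof -
  have "right_field (a1, b1, a2, b2, c) = (\<lambda>(x1, y1, x2, y2, z). (a1, b1, a2, b2, b1 * x1 + b2 * x2 + c))"
    for a1 b1 a2 b2 c
    by (auto simp: right_field_def zvec_def fun_eq_iff)
  then have "V \<in> heis_algebra \<longleftrightarrow> (\<exists>a1 b1 a2 b2 c. V = right_field (a1, b1, a2, b2, c))" for V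
    unfolding heis_algebra_eq by simp
  then show ?thesis by (simp add: set_eq_iff image_iff)
qed

lemma right_field_0 [simp]: "right_field v 0 = v"
  by (simp add: right_field_def cocycle.zero_right)

lemma heis_algebra_right_field: "V \<in> heis_algebra \<Longrightarrow> V = right_field (V 0)"
  by (auto simp: heis_algebra_eq_range)

lemma linear_right_field: "linear right_field"
  by (intro linearI)
     (auto simp: right_field_def fun_eq_iff scaleR_fun_def cocycle.add_left cocycle.scaleR_left
       scaleR_add_left scaleR_add_right)

lemma has_derivative_right_field:
  "(right_field v has_derivative (\<lambda>h. cocycle v h *\<^sub>R zvec)) (at p)"
  unfolding right_field_def
  by (auto intro!: derivative_eq_intros bounded_linear.has_derivative[OF cocycle.bounded_linear_right])

lemma frechet_derivative_right_field:
  "frechet_derivative (right_field v) (at p) = (\<lambda>h. cocycle v h *\<^sub>R zvec)"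
  by (rule frechet_derivative_at[OF has_derivative_right_field, symmetric])

lemma lie_bracket_right_field:
  "lie_bracket (right_field v) (right_field w) = right_field (symplectic_form v w *\<^sub>R zvec)"
proof
  fix p
  have "lie_bracket (right_field v) (right_field w) p = (cocycle w v - cocycle v w) *\<^sub>R zvec"
    unfolding lie_bracket_def frechet_derivative_right_field
    by (simp add: right_field_def cocycle.add_right cocycle.scaleR_right scaleR_diff_left)
  then show "lie_bracket (right_field v) (right_field w) p = right_field (symplectic_form v w *\<^sub>R zvec) p"
    by (simp add: right_field_def symplectic_form_def cocycle.scaleR_left)
qed

text \<open>Automorphisms fix the identity, so the flow does.\<close>

lemma linear_vf_at_0:
  assumes "linear_vf \<X>" shows "\<X> 0 = 0"
proof -
  obtain \<phi> where flow: "is_flow \<phi> \<X>" and iso: "\<And>t. \<phi> t \<in> iso Heis Heis"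
    using assms unfolding linear_vf_def by blast
  have fixed: "\<phi> t 0 = 0" for t
    using hom_one[OF _ group_Heis group_Heis, of "\<phi> t"] iso[of t] by (simp add: iso_def Heis_def)
  have "((\<lambda>s. \<phi> s 0) has_vector_derivative \<X> (\<phi> 0 0)) (at 0)"
    using flow unfolding is_flow_def by blast
  then have "((\<lambda>s. 0) has_vector_derivative \<X> 0) (at (0::real))"
    by (simp add: fixed)
  then show ?thesis
    using vector_derivative_unique_at has_vector_derivative_const by blast
qed

lemma linear_vf_has_derivative:
  assumes "linear_vf \<X>" shows "(\<X> has_derivative frechet_derivative \<X> (at p)) (at p)"
proof -
  have "Ck (Suc 0) \<X>" using assms by (simp add: linear_vf_def smooth_vf_def del: Ck.simps)
  then have "\<X> differentiable (at p)" unfolding Ck.simps by blast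
  then show ?thesis by (simp add: frechet_derivative_works)
qed

lemma eq_if_derivative_zero:
  fixes f :: "real \<Rightarrow> 'a::real_normed_vector"
  assumes "\<And>t. (f has_vector_derivative 0) (at t)"
  shows "f s = f t"
  by (rule has_derivative_zero_unique[of UNIV]) (use assms in \<open>auto simp: has_vector_derivative_def\<close>)

text \<open>Only the central coordinate has a nonconstant velocity, and the cocycle does not see that coordinate;
  hence \<open>cocycle w (\<gamma> t)\<close> is linear in \<open>t\<close> and the solution quadratic. This covers
  both one-parameter subgroups and the restriction of a linear field to a ray.\<close>

lemma affine_ode_solution:
  fixes \<gamma> :: "real \<Rightarrow> heis"
  assumes \<gamma>: "\<And>t. (\<gamma> has_vector_derivative v + (cocycle w (\<gamma> t) + t * k) *\<^sub>R zvec) (at t)"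
    and "\<gamma> 0 = 0"
  shows "\<gamma> t = t *\<^sub>R v + (t\<^sup>2 / 2 * (cocycle w v + k)) *\<^sub>R zvec"
proof -
  have w: "cocycle w (\<gamma> t) = t * cocycle w v" for t
  proof -
    have "((\<lambda>t. cocycle w (\<gamma> t) - t * cocycle w v) has_vector_derivative 0) (at t)" for t
      using bounded_linear.has_vector_derivative[OF cocycle.bounded_linear_right \<gamma>[of t], of w]
      by (auto intro!: derivative_eq_intros simp: cocycle.add_right cocycle.scaleR_right)
    from eq_if_derivative_zero[OF this, of t 0] show ?thesis
      by (simp add: assms(2) cocycle.zero_right)
  qed
  have "((\<lambda>t. \<gamma> t - (t *\<^sub>R v + (t\<^sup>2 / 2 * (cocycle w v + k)) *\<^sub>R zvec)) has_vector_derivative 0) (at t)" for t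
    by (rule derivative_eq_intros \<gamma> refl | simp add: w)+
       (simp add: algebra_simps)
  from eq_if_derivative_zero[OF this, of t 0] show ?thesis by (simp add: assms(2))
qed

text \<open>A linear field vanishes at the identity and its brackets with the right-invariant fields are
  prescribed by \<open>D\<close>; these brackets express the derivative of \<open>\<X>\<close> at \<open>p\<close> through the value \<open>\<X> p\<close>.
  Along the ray \<open>t *\<^sub>R p\<close> this is an ordinary differential equation that determines \<open>\<X>\<close>.\<close>

lemma linear_vf_eq_linear_field:
  assumes \<X>: "linear_vf \<X>"
    and D: "\<And>v. assoc_derivation \<X> (right_field v) = right_field (D v)" "linear D" "D zvec = \<delta> *\<^sub>R zvec"
  shows "\<X> = linear_field D \<delta>"
proof
  fix p
  let ?\<X>' = "\<lambda>p. frechet_derivative \<X> (at p)"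
  have derivation: "?\<X>' p (right_field v p) = right_field (D v) p + cocycle v (\<X> p) *\<^sub>R zvec" for p v
    using fun_cong[OF D(1), of v p]
    by (simp add: assoc_derivation_def lie_bracket_def frechet_derivative_right_field algebra_simps)
  have lin: "linear (?\<X>' p)" for p
    using linear_vf_has_derivative[OF \<X>] by (rule has_derivative_linear)
  have "?\<X>' p zvec = \<delta> *\<^sub>R zvec" for p
    using derivation[of p zvec] by (simp add: right_field_def D cocycle.scaleR_left)
  then have \<X>': "?\<X>' p v = D v + (cocycle v (\<X> p) + cocycle (D v) p - \<delta> * cocycle v p) *\<^sub>R zvec" for p v
    using derivation[of p v]
    by (simp add: right_field_def linear_add[OF lin] linear_cmul[OF lin] algebra_simps)
  define \<gamma> where "\<gamma> = (\<lambda>t. \<X> (t *\<^sub>R p))"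
  have "(\<gamma> has_vector_derivative D p + (cocycle p (\<gamma> t) + t * (cocycle (D p) p - \<delta> * cocycle p p)) *\<^sub>R zvec) (at t)" for t
  proof -
    have "((\<lambda>t. t *\<^sub>R p) has_vector_derivative p) (at t)"
      by (auto intro!: derivative_eq_intros)
    from vector_derivative_diff_chain_within[OF this has_derivative_at_withinI[OF linear_vf_has_derivative[OF \<X>]]]
    show ?thesis
      by (simp add: \<gamma>_def o_def \<X>' cocycle.scaleR_right cocycle.scaleR_left algebra_simps)
  qed
  from affine_ode_solution[OF this, of 1] show "\<X> p = linear_field D \<delta> p"
    by (simp add: \<gamma>_def linear_vf_at_0[OF \<X>] linear_field_def add_divide_distrib diff_divide_distrib
        algebra_simps)
qed

section \<open>Connected subgroups containing the center\<close>

text \<open>The exponential differs from the identity by a central term, so it maps any subspace that contains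
  the center onto itself.\<close>

lemma exp_image_right_field:
  assumes S: "subspace S" "zvec \<in> S"
  shows "exp_image (right_field ` S) = S"
proof (intro equalityI subsetI)
  fix p assume "p \<in> exp_image (right_field ` S)"
  then obtain \<gamma> v where v: "v \<in> S" "p = \<gamma> 1" "\<gamma> 0 = 0"
    "\<And>t::real. (\<gamma> has_vector_derivative right_field v (\<gamma> t)) (at t)"
    unfolding exp_image_def by (auto simp: Heis_def)
  then have "p = v + (cocycle v v / 2) *\<^sub>R zvec"
    using affine_ode_solution[of \<gamma> v v 0 1] by (simp add: right_field_def)
  then show "p \<in> S" using v(1) S by (simp add: subspace_add subspace_mul)
next
  fix p assume "p \<in> S"
  \<comment> \<open>the logarithm of \<open>p\<close>\<close>
  define v where "v = p - (cocycle p p / 2) *\<^sub>R zvec"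
  define \<gamma> where "\<gamma> = (\<lambda>t. t *\<^sub>R v + (t\<^sup>2 / 2 * cocycle v v) *\<^sub>R zvec)"
  have "v \<in> S" using \<open>p \<in> S\<close> S by (simp add: v_def subspace_diff subspace_mul)
  moreover have "(\<gamma> has_vector_derivative right_field v (\<gamma> t)) (at t)" for t
    unfolding \<gamma>_def
    by (rule derivative_eq_intros refl | simp)+
       (simp add: right_field_def cocycle.add_right cocycle.scaleR_right)
  moreover have "\<gamma> 0 = \<one>\<^bsub>Heis\<^esub>" by (simp add: \<gamma>_def Heis_def)
  moreover have "\<gamma> 1 = p"
    by (simp add: \<gamma>_def v_def cocycle.diff_left cocycle.diff_right cocycle.scaleR_left cocycle.scaleR_right)
  ultimately show "p \<in> exp_image (right_field ` S)"
    unfolding exp_image_def by (auto intro!: exI[of _ \<gamma>] exI[of _ "right_field v"])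
qed

lemma connected_lie_subgroup_right_field:
  assumes S: "subspace S" "zvec \<in> S"
  shows "connected_lie_subgroup (right_field ` S) = S"
  unfolding connected_lie_subgroup_def exp_image_right_field[OF assms]
proof (intro equalityI subsetI)
  fix p assume "p \<in> generate Heis S"
  then show "p \<in> S"
  proof induction
    case one then show ?case using S by (simp add: Heis_def subspace_0)
  next
    case (incl h) then show ?case .
  next
    case (inv h)
    have "(- h + cocycle h h *\<^sub>R zvec) \<otimes>\<^bsub>Heis\<^esub> h = \<one>\<^bsub>Heis\<^esub>"
      by (simp add: Heis_def heis_mult_eq cocycle.add_left cocycle.scaleR_left cocycle.diff_left)
    then have "inv\<^bsub>Heis\<^esub> h = - h + cocycle h h *\<^sub>R zvec"
      by (intro group.inv_equality[OF group_Heis]) (auto simp: Heis_def)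
    then show ?case using inv S by (simp add: subspace_diff subspace_mul)
  next
    case (eng g h)
    then show ?case using S by (simp add: Heis_def heis_mult_eq subspace_add subspace_mul)
  qed
qed (rule generate.incl)

lemma heis_hom_image_subspace:
  assumes A: "linear A" "A zvec = \<mu> *\<^sub>R zvec" "\<mu> \<noteq> 0" and S: "subspace S" "zvec \<in> S"
  shows "heis_hom A \<mu> ` S = A ` S"
proof (intro equalityI subsetI; elim imageE)
  fix q p assume p: "q = heis_hom A \<mu> p" "p \<in> S"
  define k where "k = (cocycle (A p) (A p) - \<mu> * cocycle p p) / 2"
  have "q = A (p + (k / \<mu>) *\<^sub>R zvec)"
    using A(3) by (simp add: p(1) heis_hom_def k_def linear_add[OF A(1)] linear_cmul[OF A(1)] A(2))
  then show "q \<in> A ` S" using p(2) S by (auto simp: subspace_add subspace_mul)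
next
  fix q p assume p: "q = A p" "p \<in> S"
  define k where "k = (cocycle (A p) (A p) - \<mu> * cocycle p p) / 2"
  have "q = heis_hom A \<mu> (p - (k / \<mu>) *\<^sub>R zvec)"
    using A(3) by (simp add: p(1) heis_hom_def k_def linear_diff[OF A(1)] linear_cmul[OF A(1)] A(2)
        cocycle.diff_left cocycle.diff_right cocycle.scaleR_left cocycle.scaleR_right)
  then show "q \<in> heis_hom A \<mu> ` S" using p(2) S by (auto simp: subspace_diff subspace_mul)
qed

section \<open>Reduction to a normal form\<close>

lemma symplectic_form_simp [simp]:
  "symplectic_form (x1, y1, x2, y2, z) (x1', y1', x2', y2', z') = x1 * y1' - y1 * x1' + x2 * y2' - y2 * x2'"
  by (simp add: symplectic_form_def)

lemma symplectic_form_linear: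
  "symplectic_form (v + v') w = symplectic_form v w + symplectic_form v' w"
  "symplectic_form v (w + w') = symplectic_form v w + symplectic_form v w'"
  "symplectic_form (r *\<^sub>R v) w = r * symplectic_form v w"
  "symplectic_form v (r *\<^sub>R w) = r * symplectic_form v w"
  by (simp_all add: symplectic_form_def cocycle.add_left cocycle.add_right cocycle.scaleR_left
      cocycle.scaleR_right algebra_simps)

lemma symplectic_form_zvec [simp]: "symplectic_form zvec v = 0" "symplectic_form v zvec = 0"
  by (simp_all add: symplectic_form_def)

lemma symplectic_form_self [simp]: "symplectic_form v v = 0"
  by (simp add: symplectic_form_def)

lemma symplectic_form_swap: "symplectic_form w v = - symplectic_form v w"
  by (simp add: symplectic_form_def)

text \<open>The matrix of the derivation, with \<open>c1\<close> in place of its entry 1: the two blocks then play symmetric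
  roles, and the second subsystem is treated by exchanging them.\<close>

definition normal_drift :: "real \<Rightarrow> real \<Rightarrow> real \<Rightarrow> real \<Rightarrow> real \<Rightarrow> real \<Rightarrow> real \<Rightarrow> heis \<Rightarrow> heis" where
  "normal_drift c1 b1 f1 c2 b2 f2 d = (\<lambda>(x1, y1, x2, y2, z).
     (b1 * y1, c1 * x1 + d * y1, b2 * y2, c2 * x2 + d * y2, f1 * y1 + f2 * y2 + d * z))"

definition normal_field :: "real \<Rightarrow> real \<Rightarrow> real \<Rightarrow> real \<Rightarrow> real \<Rightarrow> real \<Rightarrow> real \<Rightarrow> vf" where
  "normal_field c1 b1 f1 c2 b2 f2 d = linear_field (normal_drift c1 b1 f1 c2 b2 f2 d) d"

definition x1vec :: heis where "x1vec = (1, 0, 0, 0, 0)"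
definition x2vec :: heis where "x2vec = (0, 0, 1, 0, 0)"

definition first_factor :: "heis set" where
  "first_factor = {(x1, y1, 0, 0, z) | x1 y1 z. True}"

lemma linear_normal_drift: "linear (normal_drift c1 b1 f1 c2 b2 f2 d)"
  unfolding normal_drift_def by (intro linearI) (auto simp: algebra_simps)

lemma normal_drift_zvec: "normal_drift c1 b1 f1 c2 b2 f2 d zvec = d *\<^sub>R zvec"
  by (simp add: normal_drift_def zvec_def)

lemma first_factor_eq_span: "first_factor = span {x1vec, (0, 1, 0, 0, 0), zvec}"
proof (intro equalityI subsetI)
  fix p assume "p \<in> first_factor"
  then obtain x y z where "p = (x, y, 0, 0, z)" by (auto simp: first_factor_def)
  then have "p = x *\<^sub>R x1vec + y *\<^sub>R (0, 1, 0, 0, 0) + z *\<^sub>R zvec"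
    by (simp add: x1vec_def zvec_def)
  also have "\<dots> \<in> span {x1vec, (0, 1, 0, 0, 0), zvec}"
    by (intro span_add span_scale span_base) auto
  finally show "p \<in> span {x1vec, (0, 1, 0, 0, 0), zvec}" .
next
  fix p assume "p \<in> span {x1vec, (0, 1, 0, 0, 0), zvec}"
  then show "p \<in> first_factor"
    by (induction rule: span_induct_alt) (auto simp: first_factor_def x1vec_def zvec_def zero_prod_def)
qed

lemma subspace_first_factor: "subspace first_factor" and zvec_in_first_factor: "zvec \<in> first_factor"
  by (simp_all add: first_factor_eq_span subspace_span span_base)

text \<open>A map that scales a nondegenerate form is injective, hence invertible in finite dimension.\<close>

lemma symplectic_similitude_inverse:
  assumes L: "linear L" "L zvec = \<mu> *\<^sub>R zvec" "\<mu> \<noteq> 0"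
    and symp: "\<And>v w. symplectic_form (L v) (L w) = \<mu> * symplectic_form v w"
  obtains A where "linear A" "A zvec = (1 / \<mu>) *\<^sub>R zvec" "\<And>p. A (L p) = p" "\<And>p. L (A p) = p"
    "\<And>v w. symplectic_form (A v) (A w) = 1 / \<mu> * symplectic_form v w"
proof -
  have "p = 0" if "L p = 0" for p
  proof -
    have 0: "symplectic_form p q = 0" for q
      using symp[of p q] that L(3) by (simp add: symplectic_form_def cocycle.zero_left cocycle.zero_right)
    obtain x1 y1 x2 y2 z where p: "p = (x1, y1, x2, y2, z)" by (cases p)
    have "p = z *\<^sub>R zvec"
      using 0[of "(0, 1, 0, 0, 0)"] 0[of "(1, 0, 0, 0, 0)"] 0[of "(0, 0, 0, 1, 0)"] 0[of "(0, 0, 1, 0, 0)"]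
      by (simp add: p zvec_def)
    with that have "(z * \<mu>) *\<^sub>R zvec = 0" by (simp add: linear_cmul[OF L(1)] L(2))
    with L(3) \<open>p = z *\<^sub>R zvec\<close> show "p = 0" by (simp add: zvec_def zero_prod_def)
  qed
  then have "inj L" using L(1) by (simp add: linear_injective_0)
  with L(1) obtain A where A: "linear A" "\<And>p. A (L p) = p" "\<And>p. L (A p) = p"
    using linear_injective_isomorphism by blast
  show thesis
  proof (rule that[OF A(1) _ A(2,3)])
    have "A (L ((1 / \<mu>) *\<^sub>R zvec)) = A zvec"
      using L by (simp add: linear_cmul)
    then show "A zvec = (1 / \<mu>) *\<^sub>R zvec" by (simp add: A(2))
    show "symplectic_form (A v) (A w) = 1 / \<mu> * symplectic_form v w" for v w
      using symp[of "A v" "A w"] L(3) by (simp add: A(3))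
  qed
qed

text \<open>\<open>L\<close> is the frame map, sending the standard basis to the values at the identity of the given one. The
  commutation relations say that \<open>L\<close> scales the symplectic form by the factor \<open>\<mu>\<close> for which
  \<open>Z = \<mu> \<partial>/\<partial>z\<close>; the matrix of the derivation says that \<open>L\<close> conjugates \<open>normal_drift\<close> to the
  derivative \<open>E\<close> of \<open>\<X>\<close> at the identity.\<close>

lemma symplectic_basis_normal_form:
  assumes \<X>: "linear_vf \<X>" and basis: "symplectic_basis B1 Y1 B2 Y2 Z"
    and D: "assoc_derivation \<X> B1 = c1 *\<^sub>R Y1"
      "assoc_derivation \<X> Y1 = b1 *\<^sub>R B1 + d *\<^sub>R Y1 + f1 *\<^sub>R Z"
      "assoc_derivation \<X> B2 = c2 *\<^sub>R Y2"
      "assoc_derivation \<X> Y2 = b2 *\<^sub>R B2 + d *\<^sub>R Y2 + f2 *\<^sub>R Z"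
      "assoc_derivation \<X> Z = d *\<^sub>R Z"
  obtains L \<mu> E where "linear L" "L zvec = \<mu> *\<^sub>R zvec" "\<mu> \<noteq> 0"
    "\<And>v w. symplectic_form (L v) (L w) = \<mu> * symplectic_form v w"
    "linear E" "E zvec = d *\<^sub>R zvec" "\<And>p. E (L p) = L (normal_drift c1 b1 f1 c2 b2 f2 d p)"
    "\<X> = linear_field E d"
    "B1 = right_field (L x1vec)" "Y1 = right_field (L (0, 1, 0, 0, 0))" "B2 = right_field (L x2vec)"
    "Z = right_field (L zvec)"
proof -
  define e1 e2 e3 e4 where "e1 = B1 0" "e2 = Y1 0" "e3 = B2 0" "e4 = Y2 0"
  have "{B1, Y1, B2, Y2, Z} \<subseteq> heis_algebra"
    using basis span_superset by (metis symplectic_basis_def)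
  then have fields: "right_field e1 = B1" "right_field e2 = Y1" "right_field e3 = B2" "right_field e4 = Y2"
    and Z0: "right_field (Z 0) = Z"
    unfolding e1_e2_e3_e4_def using heis_algebra_right_field by (metis insert_subset)+
  have bracket: "symplectic_form v w *\<^sub>R zvec = lie_bracket (right_field v) (right_field w) 0" for v w
    by (simp add: lie_bracket_right_field)
  define \<mu> where "\<mu> = symplectic_form e1 e2"
  have \<mu>: "Z 0 = \<mu> *\<^sub>R zvec"
    using basis bracket[of e1 e2] by (simp add: \<mu>_def fields symplectic_basis_def)
  have zvec: "zvec \<noteq> 0" by (simp add: zvec_def zero_prod_def)
  have "symplectic_form e3 e4 *\<^sub>R zvec = \<mu> *\<^sub>R zvec"
    using basis bracket[of e3 e4] by (simp add: \<mu> fields symplectic_basis_def)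
  then have relations: "symplectic_form e1 e2 = \<mu>" "symplectic_form e3 e4 = \<mu>"
    "symplectic_form e1 e3 = 0" "symplectic_form e1 e4 = 0"
    "symplectic_form e2 e3 = 0" "symplectic_form e2 e4 = 0"
    using basis bracket[of e1 e3] bracket[of e1 e4] bracket[of e2 e3] bracket[of e2 e4] zvec
    by (simp_all add: \<mu>_def fields symplectic_basis_def)
  have fieldZ: "right_field (\<mu> *\<^sub>R zvec) = Z" using Z0 \<mu> by simp
  have "Z \<noteq> 0"
    using basis dependent_zero[of "{B1, Y1, B2, Y2, Z}"] by (auto simp: symplectic_basis_def)
  then have "\<mu> \<noteq> 0"
    using fieldZ linear_0[OF linear_right_field] by auto
  define L where "L = (\<lambda>(x1, y1, x2, y2, z). x1 *\<^sub>R e1 + y1 *\<^sub>R e2 + x2 *\<^sub>R e3 + y2 *\<^sub>R e4 + (z * \<mu>) *\<^sub>R zvec)"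
  have L: "L (x1, y1, x2, y2, z) = x1 *\<^sub>R e1 + y1 *\<^sub>R e2 + x2 *\<^sub>R e3 + y2 *\<^sub>R e4 + (z * \<mu>) *\<^sub>R zvec"
    for x1 y1 x2 y2 z by (simp add: L_def)
  have linL: "linear L"
    by (intro linearI) (auto simp: L scaleR_add_left scaleR_add_right algebra_simps)
  have Lzvec: "L zvec = \<mu> *\<^sub>R zvec" by (simp add: L zvec_def)
  have swapped: "symplectic_form e2 e1 = - \<mu>" "symplectic_form e4 e3 = - \<mu>"
    "symplectic_form e3 e1 = 0" "symplectic_form e4 e1 = 0"
    "symplectic_form e3 e2 = 0" "symplectic_form e4 e2 = 0"
    using relations by (subst symplectic_form_swap; simp)+
  have symp: "symplectic_form (L v) (L w) = \<mu> * symplectic_form v w" for v w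
    by (cases v; cases w) (simp add: L symplectic_form_linear relations swapped algebra_simps)
  define E where "E = frechet_derivative \<X> (at 0)"
  have linE: "linear E"
    unfolding E_def using linear_vf_has_derivative[OF \<X>] by (rule has_derivative_linear)
  have derivation: "assoc_derivation \<X> (right_field v) =
      (\<lambda>p. frechet_derivative \<X> (at p) (right_field v p) - cocycle v (\<X> p) *\<^sub>R zvec)" for v
    by (auto simp: assoc_derivation_def lie_bracket_def frechet_derivative_right_field fun_eq_iff)
  have at_0: "assoc_derivation \<X> (right_field v) 0 = E v" for v
    by (simp add: derivation E_def linear_vf_at_0[OF \<X>] cocycle.zero_right)
  have E: "E e1 = c1 *\<^sub>R e2" "E e2 = b1 *\<^sub>R e1 + d *\<^sub>R e2 + f1 *\<^sub>R \<mu> *\<^sub>R zvec"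
    "E e3 = c2 *\<^sub>R e4" "E e4 = b2 *\<^sub>R e3 + d *\<^sub>R e4 + f2 *\<^sub>R \<mu> *\<^sub>R zvec"
    "E (\<mu> *\<^sub>R zvec) = d *\<^sub>R \<mu> *\<^sub>R zvec"
    unfolding at_0[symmetric] fields fieldZ D
    by (simp_all add: scaleR_fun_def \<mu> e1_e2_e3_e4_def)
  have Ezvec: "E zvec = d *\<^sub>R zvec"
  proof -
    have "\<mu> *\<^sub>R E zvec = \<mu> *\<^sub>R d *\<^sub>R zvec"
      using E(5) by (simp add: linear_cmul[OF linE] mult.commute)
    with \<open>\<mu> \<noteq> 0\<close> show ?thesis by (simp only: scaleR_cancel_left) simp
  qed
  have inter: "E (L p) = L (normal_drift c1 b1 f1 c2 b2 f2 d p)" for p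
    by (cases p) (simp add: L normal_drift_def linear_add[OF linE] linear_cmul[OF linE] E Ezvec
        scaleR_add_left scaleR_add_right algebra_simps)
  obtain A where A: "\<And>p. L (A p) = p"
    using symplectic_similitude_inverse[OF linL Lzvec \<open>\<mu> \<noteq> 0\<close> symp] by metis
  have lin': "linear (frechet_derivative \<X> (at p))" for p
    using linear_vf_has_derivative[OF \<X>] by (rule has_derivative_linear)
  have lin_derivation: "linear (\<lambda>v. assoc_derivation \<X> (right_field v))"
    unfolding derivation
    by (intro linearI)
       (auto simp: fun_eq_iff scaleR_fun_def linear_add[OF linear_right_field] linear_cmul[OF linear_right_field]
          linear_add[OF lin'] linear_cmul[OF lin'] cocycle.add_left cocycle.scaleR_left algebra_simps)
  have "assoc_derivation \<X> (right_field v) = right_field (E v)" for v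
  proof -
    obtain x1 y1 x2 y2 z where "A v = (x1, y1, x2, y2, z)" by (cases "A v")
    with A[of v] have v: "v = x1 *\<^sub>R e1 + y1 *\<^sub>R e2 + x2 *\<^sub>R e3 + y2 *\<^sub>R e4 + z *\<^sub>R \<mu> *\<^sub>R zvec"
      by (simp add: L)
    have frame: "assoc_derivation \<X> (right_field w) = right_field (E w)"
      if "w \<in> {e1, e2, e3, e4, \<mu> *\<^sub>R zvec}" for w
      using that
      by (auto simp: fields fieldZ D E linear_add[OF linear_right_field] linear_cmul[OF linear_right_field, of _ "\<mu> *\<^sub>R zvec"]
          linear_cmul[OF linear_right_field, of _ e1] linear_cmul[OF linear_right_field, of _ e2]
          linear_cmul[OF linear_right_field, of _ e3] linear_cmul[OF linear_right_field, of _ e4]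
          simp del: scaleR_scaleR)
    have "assoc_derivation \<X> (right_field v) = x1 *\<^sub>R assoc_derivation \<X> (right_field e1)
        + y1 *\<^sub>R assoc_derivation \<X> (right_field e2) + x2 *\<^sub>R assoc_derivation \<X> (right_field e3)
        + y2 *\<^sub>R assoc_derivation \<X> (right_field e4) + z *\<^sub>R assoc_derivation \<X> (right_field (\<mu> *\<^sub>R zvec))"
      unfolding v by (simp only: linear_add[OF lin_derivation] linear_cmul[OF lin_derivation, of z]
          linear_cmul[OF lin_derivation, of _ e1] linear_cmul[OF lin_derivation, of _ e2]
          linear_cmul[OF lin_derivation, of _ e3] linear_cmul[OF lin_derivation, of _ e4])
    also have "\<dots> = x1 *\<^sub>R right_field (E e1) + y1 *\<^sub>R right_field (E e2) + x2 *\<^sub>R right_field (E e3)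
        + y2 *\<^sub>R right_field (E e4) + z *\<^sub>R right_field (E (\<mu> *\<^sub>R zvec))"
      using frame by simp
    also have "\<dots> = right_field (E v)"
      unfolding v by (simp only: linear_add[OF linE] linear_cmul[OF linE]
          linear_add[OF linear_right_field] linear_cmul[OF linear_right_field])
    finally show ?thesis .
  qed
  then have "\<X> = linear_field E d" by (rule linear_vf_eq_linear_field[OF \<X> _ linE Ezvec])
  then show thesis
    using fields fieldZ Lzvec by (intro that[OF linL Lzvec \<open>\<mu> \<noteq> 0\<close> symp linE Ezvec inter])
      (simp_all add: L x1vec_def x2vec_def)
qed

text \<open>The automorphism \<open>heis_hom L \<mu>\<close> identifies the system with its normal form, and the subgroup of the
  first block with \<open>first_factor\<close>.\<close>

lemma controllable_normal_field:
  assumes "linear_vf \<X>" and "symplectic_basis B1 Y1 B2 Y2 Z"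
    and "assoc_derivation \<X> B1 = c1 *\<^sub>R Y1"
      "assoc_derivation \<X> Y1 = b1 *\<^sub>R B1 + d *\<^sub>R Y1 + f1 *\<^sub>R Z"
      "assoc_derivation \<X> B2 = c2 *\<^sub>R Y2"
      "assoc_derivation \<X> Y2 = b2 *\<^sub>R B2 + d *\<^sub>R Y2 + f2 *\<^sub>R Z"
      "assoc_derivation \<X> Z = d *\<^sub>R Z"
  defines "N \<equiv> normal_field c1 b1 f1 c2 b2 f2 d"
  shows "controllable_on (carrier Heis) \<X> [B1, B2] \<longleftrightarrow>
      controllable_on UNIV N [right_field x1vec, right_field x2vec]"
    and "controllable_on first_factor N [right_field x1vec] \<Longrightarrow>
      controllable_on (connected_lie_subgroup (span {B1, Y1, Z})) \<X> [B1]"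
proof -
  obtain L \<mu> E where L: "linear L" "L zvec = \<mu> *\<^sub>R zvec" "\<mu> \<noteq> 0"
    and symp: "\<And>v w. symplectic_form (L v) (L w) = \<mu> * symplectic_form v w"
    and E: "linear E" "E zvec = d *\<^sub>R zvec" "\<And>p. E (L p) = L (normal_drift c1 b1 f1 c2 b2 f2 d p)"
    and \<X>: "\<X> = linear_field E d"
    and B1: "B1 = right_field (L x1vec)" and Y1: "Y1 = right_field (L (0, 1, 0, 0, 0))"
    and B2: "B2 = right_field (L x2vec)" and Z: "Z = right_field (L zvec)"
    by (rule symplectic_basis_normal_form[OF assms(1-7)]) (rule that; assumption)
  obtain A where A: "linear A" "A zvec = (1 / \<mu>) *\<^sub>R zvec" "\<And>p. A (L p) = p" "\<And>p. L (A p) = p"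
    and sympA: "\<And>v w. symplectic_form (A v) (A w) = 1 / \<mu> * symplectic_form v w"
    using symplectic_similitude_inverse[OF L symp] by metis
  have EA: "normal_drift c1 b1 f1 c2 b2 f2 d (A p) = A (E p)" for p
    using A(3)[of "normal_drift c1 b1 f1 c2 b2 f2 d (A p)"] E(3)[of "A p"] by (simp add: A(4))
  have inverse: "heis_hom L \<mu> (heis_hom A (1 / \<mu>) p) = p" "heis_hom A (1 / \<mu>) (heis_hom L \<mu> p) = p" for p
    using L(3) by (auto intro!: heis_hom_inverse L A)
  have onto: "range (heis_hom L \<mu>) = UNIV" "range (heis_hom A (1 / \<mu>)) = UNIV"
    using inverse by (metis surjI)+
  show "controllable_on (carrier Heis) \<X> [B1, B2] \<longleftrightarrow>
      controllable_on UNIV N [right_field x1vec, right_field x2vec]"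
  proof
    assume "controllable_on (carrier Heis) \<X> [B1, B2]"
    then have "controllable_on UNIV (linear_field E d) (map right_field [L x1vec, L x2vec])"
      by (simp add: \<X> B1 B2 Heis_def)
    from controllable_heis_hom_image[OF A(1,2) sympA E(1) linear_normal_drift normal_drift_zvec EA this]
    show "controllable_on UNIV N [right_field x1vec, right_field x2vec]"
      by (simp add: A(3) onto N_def normal_field_def)
  next
    assume "controllable_on UNIV N [right_field x1vec, right_field x2vec]"
    then have "controllable_on UNIV (linear_field (normal_drift c1 b1 f1 c2 b2 f2 d) d)
        (map right_field [x1vec, x2vec])"
      by (simp add: N_def normal_field_def)
    from controllable_heis_hom_image[OF L(1,2) symp linear_normal_drift E this]
    show "controllable_on (carrier Heis) \<X> [B1, B2]"
      by (simp add: \<X> B1 B2 onto Heis_def)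
  qed
  have "span {B1, Y1, Z} = span (right_field ` L ` {x1vec, (0, 1, 0, 0, 0), zvec})"
    by (simp add: B1 Y1 Z)
  also have "\<dots> = right_field ` L ` first_factor"
    by (simp only: first_factor_eq_span linear_span_image[OF linear_right_field] linear_span_image[OF L(1)])
  finally have span: "span {B1, Y1, Z} = right_field ` L ` first_factor" .
  have "zvec = L ((1 / \<mu>) *\<^sub>R zvec)" using L by (simp add: linear_cmul)
  then have "zvec \<in> L ` first_factor"
    using subspace_mul[OF subspace_first_factor zvec_in_first_factor] by blast
  moreover have "subspace (L ` first_factor)"
    by (rule linear_subspace_image[OF L(1) subspace_first_factor])
  ultimately have subgroup: "connected_lie_subgroup (span {B1, Y1, Z}) = heis_hom L \<mu> ` first_factor"
    unfolding span heis_hom_image_subspace[OF L subspace_first_factor zvec_in_first_factor]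
    by (intro connected_lie_subgroup_right_field)
  assume "controllable_on first_factor N [right_field x1vec]"
  then have "controllable_on first_factor (linear_field (normal_drift c1 b1 f1 c2 b2 f2 d) d)
      (map right_field [x1vec])"
    by (simp add: N_def normal_field_def)
  from controllable_heis_hom_image[OF L(1,2) symp linear_normal_drift E this]
  show "controllable_on (connected_lie_subgroup (span {B1, Y1, Z})) \<X> [B1]"
    by (simp add: subgroup flip: \<X> B1)
qed

section \<open>An invariant region when both blocks are convex\<close>

lemma normal_field_simp:
  "normal_field c1 b1 f1 c2 b2 f2 d (x1, y1, x2, y2, z) =
     (b1 * y1, c1 * x1 + d * y1, b2 * y2, c2 * x2 + d * y2,
      d * z + (c1 * x1\<^sup>2 + b1 * y1\<^sup>2 + c2 * x2\<^sup>2 + b2 * y2\<^sup>2) / 2 + f1 * y1 + f2 * y2)"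
  by (simp add: normal_field_def linear_field_def normal_drift_def zvec_def power2_eq_square field_simps)

lemma right_field_xvec: "right_field x1vec = (\<lambda>_. x1vec)" "right_field x2vec = (\<lambda>_. x2vec)"
  by (simp_all add: right_field_def x1vec_def x2vec_def cocycle_def)

lemma has_real_derivative_if_has_integral:
  fixes g y :: "real \<Rightarrow> real"
  assumes g: "continuous_on {0..T} g" and y: "\<And>t. t \<in> {0..T} \<Longrightarrow> (g has_integral y t - y 0) {0..t}"
    and t: "t \<in> {0..T}"
  shows "(y has_real_derivative g t) (at t within {0..T})"
proof -
  have "((\<lambda>t. y 0 + integral {0..t} g) has_vector_derivative g t) (at t within {0..T})"
    by (rule derivative_eq_intros integral_has_vector_derivative[OF g t] refl | simp)+
  then have "(y has_vector_derivative g t) (at t within {0..T})"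
    by (rule has_vector_derivative_transform[OF t, rotated]) (simp add: integral_unique[OF y])
  then show ?thesis by (simp add: has_real_derivative_iff_has_vector_derivative)
qed

text \<open>\<open>exp (- d * t) * (w t - K)\<close> is nondecreasing, whatever the sign of \<open>d\<close>.\<close>

lemma ge_if_derivative_ge_linear:
  fixes w w' :: "real \<Rightarrow> real"
  assumes w: "\<And>t. t \<in> {0..T} \<Longrightarrow> (w has_real_derivative w' t) (at t within {0..T})"
    and w': "\<And>t. t \<in> {0..T} \<Longrightarrow> d * (w t - K) \<le> w' t"
    and "K \<le> w 0" "0 \<le> T"
  shows "K \<le> w T"
proof -
  have "((\<lambda>t. exp (- d * t) * (w t - K)) has_vector_derivative exp (- d * t) * (w' t - d * (w t - K)))
      (at t within {0..T})" if "t \<in> {0..T}" for t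
    unfolding has_real_derivative_iff_has_vector_derivative[symmetric]
    by (rule derivative_eq_intros w[OF that] refl | simp)+ (simp add: algebra_simps)
  then have "((\<lambda>t. exp (- d * t) * (w' t - d * (w t - K))) has_integral
      exp (- d * T) * (w T - K) - exp (- d * 0) * (w 0 - K)) {0..T}"
    by (intro fundamental_theorem_of_calculus \<open>0 \<le> T\<close>)
  then have "0 \<le> exp (- d * T) * (w T - K) - exp (- d * 0) * (w 0 - K)"
    by (rule has_integral_nonneg) (use w' in simp)
  with \<open>K \<le> w 0\<close> have "0 \<le> exp (- d * T) * (w T - K)" by simp
  then show ?thesis by (simp add: zero_le_mult_iff)
qed

text \<open>The contribution of one block to \<open>W' - d * W\<close>, for \<open>W\<close> equal to \<open>z\<close> plus a polynomial in \<open>y\<close>. The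
  quadratic coefficient \<open>d / (4 * c)\<close> completes the square in \<open>x\<close> and leaves
  \<open>(d\<^sup>2 / 4 + b * c) / (2 * c) * y\<^sup>2\<close>; the linear coefficient \<open>2 * f / d\<close> absorbs the term \<open>f * y\<close>
  into that square. For \<open>d = 0\<close> both vanish, as \<open>2 * 0 / 0 = 0\<close>.\<close>

lemma block_growth_ge:
  fixes b c d f x y :: real
  assumes "0 < c" and "0 \<le> d\<^sup>2 / 4 + b * c" and "d = 0 \<longrightarrow> f = 0"
  shows "- (c * (2 * f / d)\<^sup>2 / 2) \<le>
    (c * x\<^sup>2 + b * y\<^sup>2) / 2 + f * y + (d / (2 * c) * y + 2 * f / d) * (c * x + d * y)
      - d * (d / (4 * c) * y\<^sup>2 + 2 * f / d * y)"
proof -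
  define \<beta> where "\<beta> = 2 * f / d"
  have f: "f = \<beta> * d / 2" using assms(3) by (cases "d = 0") (auto simp: \<beta>_def)
  have "(c * x\<^sup>2 + b * y\<^sup>2) / 2 + f * y + (d / (2 * c) * y + \<beta>) * (c * x + d * y)
      - d * (d / (4 * c) * y\<^sup>2 + \<beta> * y)
    = c / 2 * (x + d / (2 * c) * y + \<beta>)\<^sup>2 - c * \<beta>\<^sup>2 / 2 + (d\<^sup>2 / 4 + b * c) / (2 * c) * y\<^sup>2"
    using \<open>0 < c\<close> by (simp add: f field_simps power2_eq_square)
  also have "\<dots> \<ge> - (c * \<beta>\<^sup>2 / 2)" using assms(1,2) by simp
  finally show ?thesis by (simp add: \<beta>_def)
qed

text \<open>The region \<open>W \<ge> K\<close> cannot be left. The function \<open>W\<close> depends on the \<open>y\<close>'s and \<open>z\<close> only,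
  whose velocities do not contain the inputs, so it is continuously differentiable along every
  trajectory.\<close>

lemma not_controllable_normal_field:
  assumes c: "0 < c1" "0 < c2" and k: "0 \<le> d\<^sup>2 / 4 + b1 * c1" "0 \<le> d\<^sup>2 / 4 + b2 * c2"
    and f: "d = 0 \<longrightarrow> f1 = 0" "d = 0 \<longrightarrow> f2 = 0"
  shows "\<not> controllable_on UNIV (normal_field c1 b1 f1 c2 b2 f2 d) [right_field x1vec, right_field x2vec]"
proof
  define Bs where "Bs = [right_field x1vec, right_field x2vec]"
  define N where "N = normal_field c1 b1 f1 c2 b2 f2 d"
  \<comment> \<open>the threshold at which \<open>d * K\<close> balances the constants of \<open>block_growth_ge\<close>; it is 0 for \<open>d = 0\<close>\<close>
  define K where "K = (c1 * (2 * f1 / d)\<^sup>2 / 2 + c2 * (2 * f2 / d)\<^sup>2 / 2) / d"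
  assume "controllable_on UNIV (normal_field c1 b1 f1 c2 b2 f2 d) [right_field x1vec, right_field x2vec]"
  then obtain T u \<gamma> where T: "0 \<le> T" and tr: "trajectory N Bs u T \<gamma>"
    and ends: "\<gamma> 0 = (0, 0, 0, 0, K)" "\<gamma> T = (0, 0, 0, 0, K - 1)"
    unfolding controllable_on_def N_def Bs_def by blast
  define x1 where "x1 = (\<lambda>s. fst (\<gamma> s))"
  define y1 where "y1 = (\<lambda>s. fst (snd (\<gamma> s)))"
  define x2 where "x2 = (\<lambda>s. fst (snd (snd (\<gamma> s))))"
  define y2 where "y2 = (\<lambda>s. fst (snd (snd (snd (\<gamma> s)))))"
  define z where "z = (\<lambda>s. snd (snd (snd (snd (\<gamma> s)))))"
  note coords = x1_def y1_def x2_def y2_def z_def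
  have \<gamma>: "\<gamma> s = (x1 s, y1 s, x2 s, y2 s, z s)" for s by (simp add: coords)
  have "continuous_on {0..T} \<gamma>" using tr by (simp add: trajectory_def)
  then have cont: "continuous_on {0..T} x1" "continuous_on {0..T} y1" "continuous_on {0..T} x2"
    "continuous_on {0..T} y2" "continuous_on {0..T} z"
    unfolding coords by (auto intro!: continuous_intros)
  define F where "F = (\<lambda>s. N (\<gamma> s) + (\<Sum>j<length Bs. u j s *\<^sub>R (Bs ! j) (\<gamma> s)))"
  have F: "F s = (b1 * y1 s + u 0 s, c1 * x1 s + d * y1 s, b2 * y2 s + u 1 s, c2 * x2 s + d * y2 s,
      d * z s + (c1 * (x1 s)\<^sup>2 + b1 * (y1 s)\<^sup>2 + c2 * (x2 s)\<^sup>2 + b2 * (y2 s)\<^sup>2) / 2 + f1 * y1 s + f2 * y2 s)" for s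
  proof -
    have "(\<Sum>j<length Bs. u j s *\<^sub>R (Bs ! j) (\<gamma> s)) = u 0 s *\<^sub>R x1vec + u 1 s *\<^sub>R x2vec"
      by (simp add: Bs_def right_field_xvec)
    then show ?thesis
      by (simp add: F_def N_def \<gamma> normal_field_simp x1vec_def x2vec_def)
  qed
  have int: "(F has_integral \<gamma> t - \<gamma> 0) {0..t}" if "t \<in> {0..T}" for t
    using tr that by (simp add: trajectory_def F_def)
  have component: "((\<lambda>s. l (F s)) has_integral l (\<gamma> t) - l (\<gamma> 0)) {0..t}"
    if "bounded_linear l" "t \<in> {0..T}" for l :: "heis \<Rightarrow> real" and t
    using has_integral_linear[OF int[OF that(2)] that(1)] linear_diff[OF bounded_linear.linear[OF that(1)]]
    by (simp add: o_def)
  have derivatives: "(y1 has_real_derivative c1 * x1 t + d * y1 t) (at t within {0..T})"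
    "(y2 has_real_derivative c2 * x2 t + d * y2 t) (at t within {0..T})"
    "(z has_real_derivative d * z t + (c1 * (x1 t)\<^sup>2 + b1 * (y1 t)\<^sup>2 + c2 * (x2 t)\<^sup>2 + b2 * (y2 t)\<^sup>2) / 2
        + f1 * y1 t + f2 * y2 t) (at t within {0..T})" if "t \<in> {0..T}" for t
  proof -
    show "(y1 has_real_derivative c1 * x1 t + d * y1 t) (at t within {0..T})"
      using component[of "\<lambda>p. fst (snd p)"] that
      by (intro has_real_derivative_if_has_integral continuous_intros cont)
         (simp_all add: F y1_def bounded_linear_intros)
    show "(y2 has_real_derivative c2 * x2 t + d * y2 t) (at t within {0..T})"
      using component[of "\<lambda>p. fst (snd (snd (snd p)))"] that
      by (intro has_real_derivative_if_has_integral continuous_intros cont)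
         (simp_all add: F y2_def bounded_linear_intros)
    show "(z has_real_derivative d * z t + (c1 * (x1 t)\<^sup>2 + b1 * (y1 t)\<^sup>2 + c2 * (x2 t)\<^sup>2 + b2 * (y2 t)\<^sup>2) / 2
        + f1 * y1 t + f2 * y2 t) (at t within {0..T})"
      using component[of "\<lambda>p. snd (snd (snd (snd p)))"] that
      by (intro has_real_derivative_if_has_integral continuous_intros cont)
         (simp_all add: F z_def bounded_linear_intros)
  qed
  define q where "q = (\<lambda>c f y. d / (4 * c) * y\<^sup>2 + 2 * f / d * y :: real)"
  define p where "p = (\<lambda>c f x y. (d / (2 * c) * y + 2 * f / d) * (c * x + d * y) :: real)"
  define w where "w = (\<lambda>t. z t + q c1 f1 (y1 t) + q c2 f2 (y2 t))"
  define w' where "w' = (\<lambda>t. d * z t + (c1 * (x1 t)\<^sup>2 + b1 * (y1 t)\<^sup>2 + c2 * (x2 t)\<^sup>2 + b2 * (y2 t)\<^sup>2) / 2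
        + f1 * y1 t + f2 * y2 t + p c1 f1 (x1 t) (y1 t) + p c2 f2 (x2 t) (y2 t))"
  \<comment> \<open>the two block estimates add up; the nonlinear terms enter only as variables\<close>
  have combine: "l \<le> \<zeta> + (A + B + A' + B') / 2 + F + F' + P + P'"
    if "l = \<zeta> + Q + Q' - k - k'" "- k \<le> (A + B) / 2 + F + P - Q" "- k' \<le> (A' + B') / 2 + F' + P' - Q'"
    for l \<zeta> A B A' B' F F' P P' Q Q' k k' :: real
    using that by (simp add: field_simps)
  have "K \<le> w T"
  proof (rule ge_if_derivative_ge_linear[OF _ _ _ T])
    fix t assume t: "t \<in> {0..T}"
    show "(w has_real_derivative w' t) (at t within {0..T})"
      unfolding w_def q_def
      by (rule derivative_eq_intros derivatives[OF t] refl)+ (use c in \<open>simp add: w'_def p_def field_simps\<close>)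
    have "d * K = c1 * (2 * f1 / d)\<^sup>2 / 2 + c2 * (2 * f2 / d)\<^sup>2 / 2"
      using f by (cases "d = 0") (auto simp: K_def)
    then have "d * (w t - K) = d * z t + d * q c1 f1 (y1 t) + d * q c2 f2 (y2 t)
        - c1 * (2 * f1 / d)\<^sup>2 / 2 - c2 * (2 * f2 / d)\<^sup>2 / 2"
      by (simp only: w_def right_diff_distrib distrib_left)
    moreover have "- (c1 * (2 * f1 / d)\<^sup>2 / 2)
        \<le> (c1 * (x1 t)\<^sup>2 + b1 * (y1 t)\<^sup>2) / 2 + f1 * y1 t + p c1 f1 (x1 t) (y1 t) - d * q c1 f1 (y1 t)"
      unfolding p_def q_def by (rule block_growth_ge[OF c(1) k(1) f(1)])
    moreover have "- (c2 * (2 * f2 / d)\<^sup>2 / 2)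
        \<le> (c2 * (x2 t)\<^sup>2 + b2 * (y2 t)\<^sup>2) / 2 + f2 * y2 t + p c2 f2 (x2 t) (y2 t) - d * q c2 f2 (y2 t)"
      unfolding p_def q_def by (rule block_growth_ge[OF c(2) k(2) f(2)])
    ultimately show "d * (w t - K) \<le> w' t"
      unfolding w'_def by (rule combine)
  next
    show "K \<le> w 0" using ends(1) by (simp add: w_def q_def coords)
  qed
  moreover have "w T = K - 1" using ends(2) by (simp add: w_def q_def coords)
  ultimately show False by simp
qed

section \<open>Steering by prescribing the second coordinate of each block\<close>

text \<open>Put \<open>y = exp (d * s / 2) * v\<close> in a block. Up to the total derivative of \<open>- d / (4 * c) * v\<^sup>2\<close>, this is the
  contribution of the block to the derivative of \<open>exp (- d * s) * z\<close>.\<close>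

definition lagrangian :: "real \<Rightarrow> real \<Rightarrow> real \<Rightarrow> real \<Rightarrow> (real \<Rightarrow> real) \<Rightarrow> (real \<Rightarrow> real) \<Rightarrow> real \<Rightarrow> real" where
  "lagrangian c b f d v v' s =
     ((v' s)\<^sup>2 + (d\<^sup>2 / 4 + b * c) * (v s)\<^sup>2) / (2 * c) + exp (- (d / 2) * s) * (f * v s)"

text \<open>Any twice continuously differentiable \<open>v1\<close>, \<open>v2\<close> come from inputs: \<open>y' = c * x + d * y\<close> gives \<open>x\<close>, and
  then \<open>x' = b * y + u\<close> gives \<open>u\<close>. Steering is thus reduced to choosing the integrals of the two
  Lagrangians for given boundary values of \<open>v1\<close>, \<open>v2\<close> and their derivatives.\<close>

lemma reachable_normal_field:
  fixes v1 v1' v1'' v2 v2' v2'' :: "real \<Rightarrow> real"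
  assumes c: "c1 \<noteq> 0" "c2 \<noteq> 0" and T: "0 \<le> T"
    and v1: "\<And>t. (v1 has_real_derivative v1' t) (at t)" "\<And>t. (v1' has_real_derivative v1'' t) (at t)"
    and v2: "\<And>t. (v2 has_real_derivative v2' t) (at t)" "\<And>t. (v2' has_real_derivative v2'' t) (at t)"
    and cont: "continuous_on UNIV v1''" "continuous_on UNIV v2''"
    and G: "G = UNIV \<and> Bs = [right_field x1vec, right_field x2vec] \<or>
      G = first_factor \<and> Bs = [right_field x1vec] \<and> v2 = (\<lambda>_. 0) \<and> v2' = (\<lambda>_. 0) \<and> v2'' = (\<lambda>_. 0)"
  shows "reachable_within G (normal_field c1 b1 f1 c2 b2 f2 d) Bs
    ((v1' 0 - d / 2 * v1 0) / c1, v1 0, (v2' 0 - d / 2 * v2 0) / c2, v2 0, z)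
    (exp (d * T / 2) * (v1' T - d / 2 * v1 T) / c1, exp (d * T / 2) * v1 T,
     exp (d * T / 2) * (v2' T - d / 2 * v2 T) / c2, exp (d * T / 2) * v2 T,
     exp (d * T) * (z + d / (4 * c1) * ((v1 0)\<^sup>2 - (v1 T)\<^sup>2) + d / (4 * c2) * ((v2 0)\<^sup>2 - (v2 T)\<^sup>2)
       + (integral {0..T} (lagrangian c1 b1 f1 d v1 v1') + integral {0..T} (lagrangian c2 b2 f2 d v2 v2'))))"
proof -
  define E where "E = (\<lambda>t. exp (d * t / 2))"
  have E: "(E has_real_derivative d / 2 * E t) (at t)" for t
    unfolding E_def by (auto intro!: derivative_eq_intros)
  have EE: "exp (d * t) = (E t)\<^sup>2" for t
    by (simp add: E_def power2_eq_square flip: exp_add)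
  have E': "exp (- (d / 2) * t) = 1 / E t" for t
    by (simp add: E_def exp_minus field_simps)
  have E0: "E t \<noteq> 0" for t by (simp add: E_def)
  define x1 where "x1 = (\<lambda>t. E t * (v1' t - d / 2 * v1 t) / c1)"
  define x2 where "x2 = (\<lambda>t. E t * (v2' t - d / 2 * v2 t) / c2)"
  define y1 where "y1 = (\<lambda>t. E t * v1 t)"
  define y2 where "y2 = (\<lambda>t. E t * v2 t)"
  define z' where "z' = (\<lambda>t. (E t)\<^sup>2 * (z + d / (4 * c1) * ((v1 0)\<^sup>2 - (v1 t)\<^sup>2) + d / (4 * c2) * ((v2 0)\<^sup>2 - (v2 t)\<^sup>2)
       + (integral {0..t} (lagrangian c1 b1 f1 d v1 v1') + integral {0..t} (lagrangian c2 b2 f2 d v2 v2'))))"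
  define u1 where "u1 = (\<lambda>t. E t * (v1'' t - (d\<^sup>2 / 4 + b1 * c1) * v1 t) / c1)"
  define u2 where "u2 = (\<lambda>t. E t * (v2'' t - (d\<^sup>2 / 4 + b2 * c2) * v2 t) / c2)"
  define u :: "nat \<Rightarrow> real \<Rightarrow> real" where "u = (\<lambda>j. if j = 0 then u1 else u2)"
  define \<gamma> where "\<gamma> = (\<lambda>t. (x1 t, y1 t, x2 t, y2 t, z' t))"
  have cont_v: "continuous_on UNIV v1" "continuous_on UNIV v1'" "continuous_on UNIV v2" "continuous_on UNIV v2'"
    "continuous_on UNIV E"
    using v1 v2 E by (auto intro!: DERIV_continuous_on intro: has_field_derivative_at_within)
  have cont_lagrangian: "continuous_on {0..T} (lagrangian c1 b1 f1 d v1 v1')"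
    "continuous_on {0..T} (lagrangian c2 b2 f2 d v2 v2')"
    unfolding lagrangian_def
    by (intro continuous_intros continuous_on_subset[OF cont_v(1)] continuous_on_subset[OF cont_v(2)]
        continuous_on_subset[OF cont_v(3)] continuous_on_subset[OF cont_v(4)]; use c in simp)+
  have x1': "(x1 has_real_derivative b1 * y1 t + u1 t) (at t)" for t
    unfolding x1_def
    by (rule derivative_eq_intros E v1 v2 c refl)+
       (use c in \<open>simp add: y1_def u1_def field_simps power2_eq_square\<close>)
  have x2': "(x2 has_real_derivative b2 * y2 t + u2 t) (at t)" for t
    unfolding x2_def
    by (rule derivative_eq_intros E v1 v2 c refl)+
       (use c in \<open>simp add: y2_def u2_def field_simps power2_eq_square\<close>)
  have y1': "(y1 has_real_derivative c1 * x1 t + d * y1 t) (at t)" for t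
    unfolding y1_def
    by (rule derivative_eq_intros E v1 v2 refl)+ (use c in \<open>simp add: x1_def field_simps\<close>)
  have y2': "(y2 has_real_derivative c2 * x2 t + d * y2 t) (at t)" for t
    unfolding y2_def
    by (rule derivative_eq_intros E v1 v2 refl)+ (use c in \<open>simp add: x2_def field_simps\<close>)
  have z'': "(z' has_real_derivative d * z' t + (c1 * (x1 t)\<^sup>2 + b1 * (y1 t)\<^sup>2 + c2 * (x2 t)\<^sup>2 + b2 * (y2 t)\<^sup>2) / 2
      + f1 * y1 t + f2 * y2 t) (at t within {0..T})" if t: "t \<in> {0..T}" for t
  proof -
    note derivs = has_field_derivative_at_within[OF E] has_field_derivative_at_within[OF v1(1)]
      has_field_derivative_at_within[OF v2(1)]
      integral_has_vector_derivative[OF cont_lagrangian(1) t, folded has_real_derivative_iff_has_vector_derivative]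
      integral_has_vector_derivative[OF cont_lagrangian(2) t, folded has_real_derivative_iff_has_vector_derivative]
    \<comment> \<open>differentiating the boundary term completes the Lagrangian to the quadratic form in \<open>x\<close> and \<open>y\<close>\<close>
    have block: "(E t)\<^sup>2 * (- (d / (2 * c) * (v t * v' t)) + lagrangian c b f d v v' t)
        = (c * (E t * (v' t - d / 2 * v t) / c)\<^sup>2 + b * (E t * v t)\<^sup>2) / 2 + f * (E t * v t)"
      if "c \<noteq> 0" for c b f v v'
      unfolding lagrangian_def E' using that E0[of t] by (simp add: field_simps power2_eq_square)
    have "(z' has_real_derivative d * z' t
        + (E t)\<^sup>2 * (- (d / (2 * c1) * (v1 t * v1' t)) + lagrangian c1 b1 f1 d v1 v1' t)
        + (E t)\<^sup>2 * (- (d / (2 * c2) * (v2 t * v2' t)) + lagrangian c2 b2 f2 d v2 v2' t)) (at t within {0..T})"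
      unfolding z'_def
      by (rule derivative_eq_intros derivs refl)+
         (use c in \<open>simp add: field_simps power2_eq_square\<close>)
    then show ?thesis
      unfolding block[OF c(1)] block[OF c(2)] by (simp add: x1_def x2_def y1_def y2_def add_divide_distrib ac_simps)
  qed
  have "(\<gamma> has_vector_derivative (b1 * y1 t + u1 t, c1 * x1 t + d * y1 t, b2 * y2 t + u2 t, c2 * x2 t + d * y2 t,
      d * z' t + (c1 * (x1 t)\<^sup>2 + b1 * (y1 t)\<^sup>2 + c2 * (x2 t)\<^sup>2 + b2 * (y2 t)\<^sup>2) / 2 + f1 * y1 t + f2 * y2 t))
      (at t within {0..T})" if "t \<in> {0..T}" for t
    unfolding \<gamma>_def
    by (intro has_vector_derivative_Pair; unfold has_real_derivative_iff_has_vector_derivative[symmetric])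
       (rule has_field_derivative_at_within[OF x1'] has_field_derivative_at_within[OF y1']
          has_field_derivative_at_within[OF x2'] has_field_derivative_at_within[OF y2'] z''[OF that])+
  moreover have "(b1 * y1 t + u1 t, c1 * x1 t + d * y1 t, b2 * y2 t + u2 t, c2 * x2 t + d * y2 t,
      d * z' t + (c1 * (x1 t)\<^sup>2 + b1 * (y1 t)\<^sup>2 + c2 * (x2 t)\<^sup>2 + b2 * (y2 t)\<^sup>2) / 2 + f1 * y1 t + f2 * y2 t)
    = normal_field c1 b1 f1 c2 b2 f2 d (\<gamma> t) + (\<Sum>j<length Bs. u j t *\<^sub>R (Bs ! j) (\<gamma> t))" for t
  proof -
    have "(\<Sum>j<length Bs. u j t *\<^sub>R (Bs ! j) (\<gamma> t)) = u1 t *\<^sub>R x1vec + u2 t *\<^sub>R x2vec"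
      using G by (auto simp: u_def u2_def right_field_xvec)
    then show ?thesis by (simp add: \<gamma>_def normal_field_simp x1vec_def x2vec_def)
  qed
  ultimately have deriv: "(\<gamma> has_vector_derivative normal_field c1 b1 f1 c2 b2 f2 d (\<gamma> t)
      + (\<Sum>j<length Bs. u j t *\<^sub>R (Bs ! j) (\<gamma> t))) (at t within {0..T})" if "t \<in> {0..T}" for t
    using that by simp
  have "trajectory (normal_field c1 b1 f1 c2 b2 f2 d) Bs u T \<gamma>"
    unfolding trajectory_def
  proof (intro conjI ballI)
    show "continuous_on {0..T} \<gamma>"
      by (rule continuous_on_vector_derivative) (rule deriv)
    fix t assume "t \<in> {0..T}"
    then show "((\<lambda>s. normal_field c1 b1 f1 c2 b2 f2 d (\<gamma> s) + (\<Sum>j<length Bs. u j s *\<^sub>R (Bs ! j) (\<gamma> s)))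
        has_integral \<gamma> t - \<gamma> 0) {0..t}"
      by (intro fundamental_theorem_of_calculus has_vector_derivative_within_subset[OF deriv]) auto
  qed
  moreover have "admissible_input (length Bs) u"
  proof -
    have "continuous_on UNIV (u j)" for j
      unfolding u_def u1_def u2_def using c cont cont_v by (auto intro!: continuous_intros)
    then have u: "continuous_on S (u j)" for S j by (rule continuous_on_subset) simp
    have "bounded (u j ` {0..S})" for S j
      by (intro compact_imp_bounded compact_continuous_image u compact_Icc)
    moreover have "u j \<in> borel_measurable (lebesgue_on {0..})" for j
      by (intro continuous_imp_measurable_on_sets_lebesgue u) simp
    ultimately show ?thesis by (simp add: admissible_input_def)
  qed
  moreover have "\<gamma> ` {0..T} \<subseteq> G"
    using G by (auto simp: \<gamma>_def x2_def y2_def first_factor_def)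
  moreover have "\<gamma> 0 = ((v1' 0 - d / 2 * v1 0) / c1, v1 0, (v2' 0 - d / 2 * v2 0) / c2, v2 0, z)"
    by (simp add: \<gamma>_def x1_def y1_def x2_def y2_def z'_def E_def)
  ultimately show ?thesis
    unfolding reachable_within_def using T
    by (intro exI[of _ T] conjI exI[of _ u] exI[of _ \<gamma>])
       (simp_all add: \<gamma>_def x1_def y1_def x2_def y2_def z'_def EE, simp_all add: E_def)
qed

text \<open>Hermite interpolation. The last clause keeps the second block at rest when it has to stay in
  \<open>first_factor\<close>.\<close>

lemma cubic_interpolation:
  fixes T :: real
  assumes "T \<noteq> 0"
  obtains p p' p'' :: "real \<Rightarrow> real" where
    "\<And>t. (p has_real_derivative p' t) (at t)" "\<And>t. (p' has_real_derivative p'' t) (at t)"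
    "continuous_on UNIV p''" "p 0 = a" "p' 0 = b" "p T = a'" "p' T = b'"
    "a = 0 \<and> b = 0 \<and> a' = 0 \<and> b' = 0 \<Longrightarrow> p = (\<lambda>_. 0) \<and> p' = (\<lambda>_. 0) \<and> p'' = (\<lambda>_. 0)"
proof -
  define e where "e = (3 * (a' - a) - (b' + 2 * b) * T) / T\<^sup>2"
  define g where "g = (2 * (a - a') + (b + b') * T) / T ^ 3"
  show thesis
  proof (rule that)
    show "((\<lambda>t. a + b * t + e * t\<^sup>2 + g * t ^ 3) has_real_derivative b + 2 * e * t + 3 * g * t\<^sup>2) (at t)" for t
      by (rule derivative_eq_intros refl)+ (simp add: algebra_simps power2_eq_square)
    show "((\<lambda>t. b + 2 * e * t + 3 * g * t\<^sup>2) has_real_derivative 2 * e + 6 * g * t) (at t)" for t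
      by (rule derivative_eq_intros refl)+ (simp add: algebra_simps)
    show "continuous_on UNIV (\<lambda>t. 2 * e + 6 * g * t)" by (intro continuous_intros)
    show "a + b * T + e * T\<^sup>2 + g * T ^ 3 = a'" "b + 2 * e * T + 3 * g * T\<^sup>2 = b'"
      using assms by (simp_all add: e_def g_def field_simps power2_eq_square power3_eq_cube)
  qed (simp_all add: e_def g_def)
qed

lemma integral_oscillation:
  fixes c k \<omega> T :: real
  assumes "c \<noteq> 0" "\<omega> \<noteq> 0" "0 \<le> T" "sin (\<omega> * T) = 0"
  shows "((\<lambda>s. ((\<omega> * sin (\<omega> * s))\<^sup>2 + k * (1 - cos (\<omega> * s))\<^sup>2) / (2 * c)) has_integral
    T * (\<omega>\<^sup>2 + 3 * k) / (4 * c)) {0..T}"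
proof -
  define S where "S = (\<lambda>s. sin (\<omega> * s) / \<omega>)"
  define P where "P = (\<lambda>s. sin (\<omega> * s) * cos (\<omega> * s) / (2 * \<omega>))"
  define h where "h = (\<lambda>s. (\<omega>\<^sup>2 * (s / 2 - P s) + k * (3 * s / 2 - 2 * S s + P s)) / (2 * c))"
  have cos: "cos x * cos x = 1 - sin x * sin x" for x :: real
    using sin_cos_squared_add[of x] by (simp add: power2_eq_square)
  have S: "(S has_real_derivative cos (\<omega> * s)) (at s)" for s
    unfolding S_def by (rule derivative_eq_intros refl | use assms in simp)+
  have P: "(P has_real_derivative 1 / 2 - (sin (\<omega> * s))\<^sup>2) (at s)" for s
  proof -
    have "(P has_real_derivative (cos (\<omega> * s) * cos (\<omega> * s) - sin (\<omega> * s) * sin (\<omega> * s)) / 2) (at s)"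
      unfolding P_def
      using assms(2) by (auto intro!: derivative_eq_intros simp: field_simps)
    then show ?thesis by (simp add: cos power2_eq_square field_simps)
  qed
  have "(h has_real_derivative ((\<omega> * sin (\<omega> * s))\<^sup>2 + k * (1 - cos (\<omega> * s))\<^sup>2) / (2 * c)) (at s)" for s
  proof -
    have "(h has_real_derivative (\<omega>\<^sup>2 * (1 / 2 - (1 / 2 - (sin (\<omega> * s))\<^sup>2))
        + k * (3 * 1 / 2 - 2 * cos (\<omega> * s) + (1 / 2 - (sin (\<omega> * s))\<^sup>2))) / (2 * c)) (at s)"
      unfolding h_def by (intro DERIV_cdivide DERIV_add DERIV_diff DERIV_cmult DERIV_ident S P)
    moreover have "3 * 1 / 2 - 2 * cos x + (1 / 2 - (sin x)\<^sup>2) = (1 - cos x)\<^sup>2" for x :: real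
      using cos[of x] by (simp add: power2_eq_square algebra_simps)
    ultimately show ?thesis by (simp add: power_mult_distrib)
  qed
  then have "((\<lambda>s. ((\<omega> * sin (\<omega> * s))\<^sup>2 + k * (1 - cos (\<omega> * s))\<^sup>2) / (2 * c)) has_integral h T - h 0) {0..T}"
    using assms(3)
    by (intro fundamental_theorem_of_calculus)
       (auto simp flip: has_real_derivative_iff_has_vector_derivative intro: has_field_derivative_at_within)
  moreover have "h T - h 0 = T * (\<omega>\<^sup>2 + 3 * k) / (4 * c)"
    using assms by (simp add: h_def S_def P_def field_simps)
  ultimately show ?thesis by simp
qed

text \<open>The coefficient of \<open>r\<close> in the Lagrangian of \<open>p + r * (1 - cos (\<omega> * s))\<close>.\<close>

definition oscillation_cross_term ::
    "real \<Rightarrow> real \<Rightarrow> real \<Rightarrow> real \<Rightarrow> real \<Rightarrow> (real \<Rightarrow> real) \<Rightarrow> (real \<Rightarrow> real) \<Rightarrow> real \<Rightarrow> real" where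
  "oscillation_cross_term c b f d \<omega> p p' s =
     (p' s * (\<omega> * sin (\<omega> * s)) + (d\<^sup>2 / 4 + b * c) * (p s * (1 - cos (\<omega> * s)))) / c
       + exp (- (d / 2) * s) * (f * (1 - cos (\<omega> * s)))"

text \<open>Superposing \<open>r * (1 - cos (\<omega> * s))\<close> over whole periods keeps the boundary data. The coefficient of
  \<open>r\<^sup>2\<close> has the sign of \<open>(\<omega>\<^sup>2 + 3 * k) / c\<close> with \<open>k = d\<^sup>2 / 4 + b * c\<close>: that of \<open>c\<close> for fast
  oscillations, and the opposite one for slow oscillations if \<open>k < 0\<close>.\<close>

lemma integral_lagrangian_oscillation:
  assumes "c \<noteq> 0" "\<omega> \<noteq> 0" "0 \<le> T" "sin (\<omega> * T) = 0"
    and cont: "continuous_on UNIV p" "continuous_on UNIV p'"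
  shows "integral {0..T} (lagrangian c b f d (\<lambda>s. p s + r * (1 - cos (\<omega> * s))) (\<lambda>s. p' s + r * (\<omega> * sin (\<omega> * s))))
    = integral {0..T} (lagrangian c b f d p p') + r * integral {0..T} (oscillation_cross_term c b f d \<omega> p p')
      + r\<^sup>2 * (T * (\<omega>\<^sup>2 + 3 * (d\<^sup>2 / 4 + b * c)) / (4 * c))"
proof -
  define k where "k = d\<^sup>2 / 4 + b * c"
  have "continuous_on {0..T} (lagrangian c b f d p p')"
    unfolding lagrangian_def
    by (intro continuous_intros continuous_on_subset[OF cont(1)] continuous_on_subset[OF cont(2)]; use assms(1) in simp)
  then have 0: "(lagrangian c b f d p p' has_integral integral {0..T} (lagrangian c b f d p p')) {0..T}"
    by (intro integrable_integral integrable_continuous_real)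
  have "continuous_on {0..T} (oscillation_cross_term c b f d \<omega> p p')"
    unfolding oscillation_cross_term_def
    by (intro continuous_intros continuous_on_subset[OF cont(1)] continuous_on_subset[OF cont(2)]; use assms(1) in simp)
  then have 1: "(oscillation_cross_term c b f d \<omega> p p' has_integral integral {0..T} (oscillation_cross_term c b f d \<omega> p p')) {0..T}"
    by (intro integrable_integral integrable_continuous_real)
  have "lagrangian c b f d (\<lambda>s. p s + r * (1 - cos (\<omega> * s))) (\<lambda>s. p' s + r * (\<omega> * sin (\<omega> * s))) =
      (\<lambda>s. lagrangian c b f d p p' s + r * oscillation_cross_term c b f d \<omega> p p' s
        + r\<^sup>2 * (((\<omega> * sin (\<omega> * s))\<^sup>2 + k * (1 - cos (\<omega> * s))\<^sup>2) / (2 * c)))" (is "?l = ?r")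
  proof
    fix s
    have expand: "((w + r * w1)\<^sup>2 + k * (v + r * v1)\<^sup>2) / (2 * c) + e * (f * (v + r * v1)) =
      (w\<^sup>2 + k * v\<^sup>2) / (2 * c) + e * (f * v) + r * ((w * w1 + k * (v * v1)) / c + e * (f * v1))
        + r\<^sup>2 * ((w1\<^sup>2 + k * v1\<^sup>2) / (2 * c))" for v v1 w w1 e :: real
      using assms(1) by (simp add: field_simps power2_eq_square)
    show "?l s = ?r s"
      unfolding lagrangian_def oscillation_cross_term_def k_def[symmetric] by (rule expand)
  qed
  moreover have "(?r has_integral integral {0..T} (lagrangian c b f d p p')
      + r * integral {0..T} (oscillation_cross_term c b f d \<omega> p p')
      + r\<^sup>2 * (T * (\<omega>\<^sup>2 + 3 * k) / (4 * c))) {0..T}"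
    by (intro has_integral_add has_integral_mult_right 0 1 integral_oscillation assms)
  ultimately show ?thesis by (simp add: k_def integral_unique)
qed

lemma quadratic_attains_nonneg:
  fixes a b r :: real
  assumes "0 < a" "0 \<le> r"
  shows "\<exists>x. b * x + x\<^sup>2 * a = r"
proof
  define S where "S = sqrt (b\<^sup>2 + 4 * a * r)"
  have "S\<^sup>2 = b\<^sup>2 + 4 * a * r" using assms by (simp add: S_def)
  then show "b * ((S - b) / (2 * a)) + ((S - b) / (2 * a))\<^sup>2 * a = r"
    using assms(1) by (simp add: power_divide) (simp add: field_simps power2_eq_square)
qed

lemma exists_fast_frequency:
  fixes k :: real
  obtains n :: nat where "0 < n" "0 < (real n)\<^sup>2 + k"
proof -
  obtain n :: nat where n: "\<bar>k\<bar> + 1 < real n" using reals_Archimedean2 by blast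
  then have "real n * 1 \<le> real n * real n" by (intro mult_left_mono) auto
  with n show thesis by (intro that[of n]) (auto simp: power2_eq_square)
qed

section \<open>Controllability of the normal form\<close>

text \<open>The whole system, or its first subsystem on the subgroup of the first block: the motions below serve for
  both, those of the second kind keeping the second block at rest.\<close>

definition normal_input_set :: "heis set \<Rightarrow> vf list \<Rightarrow> bool" where
  "normal_input_set G Bs \<longleftrightarrow> G = UNIV \<and> Bs = [right_field x1vec, right_field x2vec] \<or>
      G = first_factor \<and> Bs = [right_field x1vec]"

text \<open>With \<open>0 < c1\<close>, fast oscillations of the first block raise \<open>z\<close> by any amount; \<open>C\<close> records what the
  interpolating path alone contributes.\<close>

lemma reachable_above:
  assumes c: "0 < c1" "c2 \<noteq> 0" and G: "normal_input_set G Bs"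
    and ends: "(x1, y1, x2, y2, z0) \<in> G" "(x1', y1', x2', y2', z0') \<in> G"
  obtains C where "\<And>z \<zeta>. exp (d * (2 * pi)) * (z + C) \<le> \<zeta> \<Longrightarrow>
    reachable_within G (normal_field c1 b1 f1 c2 b2 f2 d) Bs (x1, y1, x2, y2, z) (x1', y1', x2', y2', \<zeta>)"
proof -
  define T where "T = 2 * pi"
  define E where "E = exp (d * T / 2)"
  have T: "0 < T" "T \<noteq> 0" and "E \<noteq> 0" by (simp_all add: T_def E_def)
  obtain n where n: "0 < n" "0 < (real n)\<^sup>2 + 3 * (d\<^sup>2 / 4 + b1 * c1)" by (rule exists_fast_frequency)
  have trig: "sin (real n * T) = 0" "cos (real n * T) = 1"
    using sin_2npi[of n] cos_2npi[of n] by (simp_all only: T_def mult.assoc mult.left_commute[of 2])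
  obtain p1 p1' p1'' where p1: "\<And>t. (p1 has_real_derivative p1' t) (at t)"
      "\<And>t. (p1' has_real_derivative p1'' t) (at t)" "continuous_on UNIV p1''"
      "p1 0 = y1" "p1' 0 = c1 * x1 + d / 2 * y1" "p1 T = y1' / E" "p1' T = c1 * x1' / E + d / 2 * (y1' / E)"
    by (rule cubic_interpolation[OF T(2)]) (rule that; assumption)
  obtain p2 p2' p2'' where p2: "\<And>t. (p2 has_real_derivative p2' t) (at t)"
      "\<And>t. (p2' has_real_derivative p2'' t) (at t)" "continuous_on UNIV p2''"
      "p2 0 = y2" "p2' 0 = c2 * x2 + d / 2 * y2" "p2 T = y2' / E" "p2' T = c2 * x2' / E + d / 2 * (y2' / E)"
      "y2 = 0 \<and> c2 * x2 + d / 2 * y2 = 0 \<and> y2' / E = 0 \<and> c2 * x2' / E + d / 2 * (y2' / E) = 0 \<Longrightarrow>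
        p2 = (\<lambda>_. 0) \<and> p2' = (\<lambda>_. 0) \<and> p2'' = (\<lambda>_. 0)"
    by (rule cubic_interpolation[OF T(2)]) (rule that; assumption)
  have cont: "continuous_on UNIV p1" "continuous_on UNIV p1'"
    using p1 by (auto intro!: DERIV_continuous_on intro: has_field_derivative_at_within)
  have G': "G = UNIV \<and> Bs = [right_field x1vec, right_field x2vec] \<or>
      G = first_factor \<and> Bs = [right_field x1vec] \<and> p2 = (\<lambda>_. 0) \<and> p2' = (\<lambda>_. 0) \<and> p2'' = (\<lambda>_. 0)"
    using G ends p2(8) by (auto simp: normal_input_set_def first_factor_def)
  define J where "J = integral {0..T} (oscillation_cross_term c1 b1 f1 d (real n) p1 p1')"
  define a where "a = T * ((real n)\<^sup>2 + 3 * (d\<^sup>2 / 4 + b1 * c1)) / (4 * c1)"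
  define C where "C = d / (4 * c1) * (y1\<^sup>2 - (y1' / E)\<^sup>2) + d / (4 * c2) * (y2\<^sup>2 - (y2' / E)\<^sup>2)
    + integral {0..T} (lagrangian c1 b1 f1 d p1 p1') + integral {0..T} (lagrangian c2 b2 f2 d p2 p2')"
  have "0 < a" using n T c by (simp add: a_def)
  show thesis
  proof (rule that)
    fix z \<zeta> assume "exp (d * (2 * pi)) * (z + C) \<le> \<zeta>"
    then have "0 \<le> \<zeta> / exp (d * T) - (z + C)" by (simp add: T_def field_simps)
    then obtain r where r: "J * r + r\<^sup>2 * a = \<zeta> / exp (d * T) - (z + C)"
      using quadratic_attains_nonneg[OF \<open>0 < a\<close>] by blast
    define v1 where "v1 = (\<lambda>s. p1 s + r * (1 - cos (real n * s)))"
    define v1' where "v1' = (\<lambda>s. p1' s + r * (real n * sin (real n * s)))"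
    define v1'' where "v1'' = (\<lambda>s. p1'' s + r * (real n * (real n * cos (real n * s))))"
    have v1: "(v1 has_real_derivative v1' t) (at t)" "(v1' has_real_derivative v1'' t) (at t)" for t
      unfolding v1_def v1'_def v1''_def by (rule derivative_eq_intros p1 refl | simp)+
    have "continuous_on UNIV v1''" unfolding v1''_def by (intro continuous_intros p1)
    have boundary: "v1 0 = y1" "v1' 0 = c1 * x1 + d / 2 * y1" "v1 T = y1' / E" "v1' T = c1 * x1' / E + d / 2 * (y1' / E)"
      by (simp_all add: v1_def v1'_def p1 trig)
    have "integral {0..T} (lagrangian c1 b1 f1 d v1 v1') = integral {0..T} (lagrangian c1 b1 f1 d p1 p1') + r * J + r\<^sup>2 * a"
      unfolding v1_def v1'_def J_def a_def using c n T trig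
      by (intro integral_lagrangian_oscillation cont) auto
    then have "z + d / (4 * c1) * ((v1 0)\<^sup>2 - (v1 T)\<^sup>2) + d / (4 * c2) * ((p2 0)\<^sup>2 - (p2 T)\<^sup>2)
        + (integral {0..T} (lagrangian c1 b1 f1 d v1 v1') + integral {0..T} (lagrangian c2 b2 f2 d p2 p2'))
        = (z + C) + (J * r + r\<^sup>2 * a)"
      unfolding boundary p2(4,6) C_def by simp
    then have \<zeta>: "exp (d * T) * (z + d / (4 * c1) * ((v1 0)\<^sup>2 - (v1 T)\<^sup>2) + d / (4 * c2) * ((p2 0)\<^sup>2 - (p2 T)\<^sup>2)
        + (integral {0..T} (lagrangian c1 b1 f1 d v1 v1') + integral {0..T} (lagrangian c2 b2 f2 d p2 p2'))) = \<zeta>"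
      by (simp add: r)
    have "reachable_within G (normal_field c1 b1 f1 c2 b2 f2 d) Bs
      ((v1' 0 - d / 2 * v1 0) / c1, v1 0, (p2' 0 - d / 2 * p2 0) / c2, p2 0, z)
      (E * (v1' T - d / 2 * v1 T) / c1, E * v1 T, E * (p2' T - d / 2 * p2 T) / c2, E * p2 T, \<zeta>)"
      using reachable_normal_field[where ?b1.0 = b1 and ?f1.0 = f1 and ?b2.0 = b2 and ?f2.0 = f2 and d = d and z = z,
          OF _ c(2) _ v1 p2(1,2) \<open>continuous_on UNIV v1''\<close> p2(3) G', of c1 T] c T
      unfolding \<zeta> E_def by simp
    then show "reachable_within G (normal_field c1 b1 f1 c2 b2 f2 d) Bs (x1, y1, x2, y2, z) (x1', y1', x2', y2', \<zeta>)"
      using c \<open>E \<noteq> 0\<close> by (simp add: boundary p2)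
  qed
qed

text \<open>Closed motions of the pairs \<open>(xj, yj)\<close> based at the origin change \<open>z\<close> only.\<close>

lemma reachable_loop:
  assumes c: "c1 \<noteq> 0" "c2 \<noteq> 0" and G: "normal_input_set G Bs" "Bs = [right_field x1vec, right_field x2vec] \<or> r2 = 0"
    and \<omega>: "\<omega> \<noteq> 0" "0 \<le> T" "sin (\<omega> * T) = 0" "cos (\<omega> * T) = 1"
  shows "reachable_within G (normal_field c1 b1 f1 c2 b2 f2 d) Bs (0, 0, 0, 0, z)
    (0, 0, 0, 0, exp (d * T) * (z
      + (r1 * integral {0..T} (oscillation_cross_term c1 b1 f1 d \<omega> (\<lambda>_. 0) (\<lambda>_. 0))
         + r1\<^sup>2 * (T * (\<omega>\<^sup>2 + 3 * (d\<^sup>2 / 4 + b1 * c1)) / (4 * c1)))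
      + (r2 * integral {0..T} (oscillation_cross_term c2 b2 f2 d \<omega> (\<lambda>_. 0) (\<lambda>_. 0))
         + r2\<^sup>2 * (T * (\<omega>\<^sup>2 + 3 * (d\<^sup>2 / 4 + b2 * c2)) / (4 * c2)))))"
proof -
  define v where "v = (\<lambda>r s. 0 + r * (1 - cos (\<omega> * s)))"
  define v' where "v' = (\<lambda>r s. 0 + r * (\<omega> * sin (\<omega> * s)))"
  define v'' where "v'' = (\<lambda>r s. r * (\<omega> * (\<omega> * cos (\<omega> * s))))"
  have v: "(v r has_real_derivative v' r t) (at t)" "(v' r has_real_derivative v'' r t) (at t)" for r t
    unfolding v_def v'_def v''_def by (rule derivative_eq_intros refl | simp)+
  have v'': "continuous_on UNIV (v'' r)" for r unfolding v''_def by (intro continuous_intros)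
  have "lagrangian c b f d (\<lambda>_. 0) (\<lambda>_. 0) = (\<lambda>_. 0)" for c b f by (simp add: lagrangian_def fun_eq_iff)
  then have J: "integral {0..T} (lagrangian c b f d (v r) (v' r))
    = r * integral {0..T} (oscillation_cross_term c b f d \<omega> (\<lambda>_. 0) (\<lambda>_. 0))
         + r\<^sup>2 * (T * (\<omega>\<^sup>2 + 3 * (d\<^sup>2 / 4 + b * c)) / (4 * c))" if "c \<noteq> 0" for c b f r
    unfolding v_def v'_def using that \<omega>
    by (subst integral_lagrangian_oscillation) auto
  have closed: "v r 0 = 0" "v' r 0 = 0" "v r T = 0" "v' r T = 0" for r
    using \<omega> by (simp_all add: v_def v'_def)
  have "G = UNIV \<and> Bs = [right_field x1vec, right_field x2vec] \<or>
      G = first_factor \<and> Bs = [right_field x1vec] \<and> v r2 = (\<lambda>_. 0) \<and> v' r2 = (\<lambda>_. 0) \<and> v'' r2 = (\<lambda>_. 0)"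
    using G by (auto simp: normal_input_set_def v_def v'_def v''_def first_factor_def)
  from reachable_normal_field[where ?b1.0 = b1 and ?f1.0 = f1 and ?b2.0 = b2 and ?f2.0 = f2 and d = d and z = z,
      OF c \<omega>(2) v[of r1] v[of r2] v'' v'' this]
  show ?thesis by (simp add: closed J c add.assoc)
qed

text \<open>By \<open>reachable_above\<close> the target is reached from any point of the central axis that is low enough. So it
  suffices to go to the axis, descend along it, and leave it.\<close>

lemma controllable_if_descends:
  assumes c: "0 < c1" "c2 \<noteq> 0" and G: "normal_input_set G Bs"
    and descends: "\<And>z M. \<exists>z'\<le>M. reachable_within G (normal_field c1 b1 f1 c2 b2 f2 d) Bs (0, 0, 0, 0, z) (0, 0, 0, 0, z')"
  shows "controllable_on G (normal_field c1 b1 f1 c2 b2 f2 d) Bs"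
  unfolding controllable_on_iff_reachable
proof (intro ballI)
  fix g h assume "g \<in> G" "h \<in> G"
  obtain x1 y1 x2 y2 z where g: "g = (x1, y1, x2, y2, z)" by (cases g)
  obtain x1' y1' x2' y2' \<zeta> where h: "h = (x1', y1', x2', y2', \<zeta>)" by (cases h)
  have origin: "(0, 0, 0, 0, 0) \<in> G" using G by (auto simp: normal_input_set_def first_factor_def)
  obtain C1 where C1: "\<And>z \<zeta>. exp (d * (2 * pi)) * (z + C1) \<le> \<zeta> \<Longrightarrow>
      reachable_within G (normal_field c1 b1 f1 c2 b2 f2 d) Bs (x1, y1, x2, y2, z) (0, 0, 0, 0, \<zeta>)"
    using reachable_above[OF c G _ origin] \<open>g \<in> G\<close> unfolding g by blast
  obtain C2 where C2: "\<And>z \<zeta>. exp (d * (2 * pi)) * (z + C2) \<le> \<zeta> \<Longrightarrow>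
      reachable_within G (normal_field c1 b1 f1 c2 b2 f2 d) Bs (0, 0, 0, 0, z) (x1', y1', x2', y2', \<zeta>)"
    using reachable_above[OF c G origin] \<open>h \<in> G\<close> unfolding h by blast
  obtain z' where z': "z' \<le> \<zeta> / exp (d * (2 * pi)) - C2"
    "reachable_within G (normal_field c1 b1 f1 c2 b2 f2 d) Bs (0, 0, 0, 0, exp (d * (2 * pi)) * (z + C1)) (0, 0, 0, 0, z')"
    using descends by blast
  have "exp (d * (2 * pi)) * (z' + C2) \<le> \<zeta>"
    using z'(1) by (simp add: field_simps)
  from reachable_within_trans[OF reachable_within_trans[OF C1[OF order_refl] z'(2)] C2[OF this]]
  show "reachable_within G (normal_field c1 b1 f1 c2 b2 f2 d) Bs g h" by (simp add: g h)
qed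

lemma scaled_quadratic_unbounded_below:
  fixes a b e z M :: real
  assumes "a < 0" "0 < e"
  shows "\<exists>r. e * (z + (r * b + r\<^sup>2 * a)) \<le> M"
proof -
  have "0 \<le> - min 0 (M / e - z)" by simp
  then obtain r where "- b * r + r\<^sup>2 * - a = - min 0 (M / e - z)"
    using quadratic_attains_nonneg[of "- a" "- min 0 (M / e - z)" "- b"] assms(1) by auto
  then have "z + (r * b + r\<^sup>2 * a) \<le> M / e" by (simp add: algebra_simps min_def split: if_splits)
  then show ?thesis using assms(2) by (intro exI[of _ r]) (simp add: field_simps)
qed

text \<open>The kinetic term of the second block is negative, so its fast oscillations lower \<open>z\<close>.\<close>

lemma controllable_opposite_signs:
  assumes "0 < c1" "c2 < 0"
  shows "controllable_on UNIV (normal_field c1 b1 f1 c2 b2 f2 d) [right_field x1vec, right_field x2vec]"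
proof (rule controllable_if_descends)
  fix z M
  obtain n where n: "0 < n" "0 < (real n)\<^sup>2 + 3 * (d\<^sup>2 / 4 + b2 * c2)" by (rule exists_fast_frequency)
  have trig: "sin (real n * (2 * pi)) = 0" "cos (real n * (2 * pi)) = 1"
    using sin_2npi[of n] cos_2npi[of n] by (simp_all only: mult.assoc mult.left_commute[of 2])
  have "2 * pi * ((real n)\<^sup>2 + 3 * (d\<^sup>2 / 4 + b2 * c2)) / (4 * c2) < 0"
    using n assms by (simp add: divide_pos_neg)
  then obtain r where "exp (d * (2 * pi)) * (z
      + (r * integral {0..2 * pi} (oscillation_cross_term c2 b2 f2 d (real n) (\<lambda>_. 0) (\<lambda>_. 0))
         + r\<^sup>2 * (2 * pi * ((real n)\<^sup>2 + 3 * (d\<^sup>2 / 4 + b2 * c2)) / (4 * c2)))) \<le> M"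
    using scaled_quadratic_unbounded_below exp_gt_zero by blast
  moreover have "reachable_within UNIV (normal_field c1 b1 f1 c2 b2 f2 d) [right_field x1vec, right_field x2vec]
      (0, 0, 0, 0, z) (0, 0, 0, 0, exp (d * (2 * pi)) * (z
      + (r * integral {0..2 * pi} (oscillation_cross_term c2 b2 f2 d (real n) (\<lambda>_. 0) (\<lambda>_. 0))
         + r\<^sup>2 * (2 * pi * ((real n)\<^sup>2 + 3 * (d\<^sup>2 / 4 + b2 * c2)) / (4 * c2)))))"
    using reachable_loop[where G = UNIV and Bs = "[right_field x1vec, right_field x2vec]" and \<omega> = "real n"
        and T = "2 * pi" and ?r1.0 = 0 and ?r2.0 = r and ?c1.0 = c1 and ?c2.0 = c2
        and ?b1.0 = b1 and ?b2.0 = b2 and ?f1.0 = f1 and ?f2.0 = f2 and d = d and z = z] trig assms n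
    by (simp add: normal_input_set_def)
  ultimately show "\<exists>z'\<le>M. reachable_within UNIV (normal_field c1 b1 f1 c2 b2 f2 d)
      [right_field x1vec, right_field x2vec] (0, 0, 0, 0, z) (0, 0, 0, 0, z')"
    by blast
qed (use assms in \<open>auto simp: normal_input_set_def\<close>)

text \<open>If \<open>d\<^sup>2 / 4 + b1 * c1 < 0\<close>, slow oscillations of large amplitude lower \<open>z\<close>. If instead \<open>d = 0\<close> and
  \<open>f1 \<noteq> 0\<close>, the linear term makes one loop of a suitable amplitude lower \<open>z\<close> by a fixed amount,
  and repeating it lowers \<open>z\<close> without bound.\<close>

lemma controllable_first_factor:
  assumes c: "0 < c1" "c2 \<noteq> 0" and k: "d\<^sup>2 / 4 + b1 * c1 < 0 \<or> d = 0 \<and> f1 \<noteq> 0"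
  shows "controllable_on first_factor (normal_field c1 b1 f1 c2 b2 f2 d) [right_field x1vec]"
proof (rule controllable_if_descends[OF c])
  let ?R = "reachable_within first_factor (normal_field c1 b1 f1 c2 b2 f2 d) [right_field x1vec]"
  show G: "normal_input_set first_factor [right_field x1vec]" by (simp add: normal_input_set_def)
  fix z M
  show "\<exists>z'\<le>M. ?R (0, 0, 0, 0, z) (0, 0, 0, 0, z')"
  proof (cases "d\<^sup>2 / 4 + b1 * c1 < 0")
    case True
    \<comment> \<open>with this frequency \<open>\<omega>\<^sup>2 + 3 * k = 2 * k < 0\<close> for \<open>k = d\<^sup>2 / 4 + b1 * c1\<close>\<close>
    define \<omega> where "\<omega> = sqrt (- (d\<^sup>2 / 4 + b1 * c1))"
    have \<omega>: "0 < \<omega>" "\<omega>\<^sup>2 = - (d\<^sup>2 / 4 + b1 * c1)" using True by (simp_all add: \<omega>_def)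
    define T where "T = 2 * pi / \<omega>"
    have T: "0 < T" "\<omega> * T = 2 * pi" using \<omega> by (simp_all add: T_def)
    have "T * (\<omega>\<^sup>2 + 3 * (d\<^sup>2 / 4 + b1 * c1)) / (4 * c1) < 0"
      using T c True by (intro divide_neg_pos mult_pos_neg) (auto simp: \<omega>)
    then obtain r where "exp (d * T) * (z + (r * integral {0..T} (oscillation_cross_term c1 b1 f1 d \<omega> (\<lambda>_. 0) (\<lambda>_. 0))
         + r\<^sup>2 * (T * (\<omega>\<^sup>2 + 3 * (d\<^sup>2 / 4 + b1 * c1)) / (4 * c1)))) \<le> M"
      using scaled_quadratic_unbounded_below exp_gt_zero by blast
    moreover have "?R (0, 0, 0, 0, z) (0, 0, 0, 0, exp (d * T) * (z
         + (r * integral {0..T} (oscillation_cross_term c1 b1 f1 d \<omega> (\<lambda>_. 0) (\<lambda>_. 0))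
         + r\<^sup>2 * (T * (\<omega>\<^sup>2 + 3 * (d\<^sup>2 / 4 + b1 * c1)) / (4 * c1)))))"
      using reachable_loop[OF _ c(2) G, where ?r1.0 = r and ?r2.0 = 0 and ?c1.0 = c1
        and ?b1.0 = b1 and ?b2.0 = b2 and ?f1.0 = f1 and ?f2.0 = f2 and d = d and z = z and T = T and \<omega> = \<omega>] \<omega> T c by simp
    ultimately show ?thesis by blast
  next
    case False
    then have d: "d = 0" "f1 \<noteq> 0" and k: "0 \<le> b1 * c1" using k by auto
    define a where "a = (1 + 3 * (b1 * c1)) / (4 * c1)"
    have "0 < a" using c k by (simp add: a_def)
    obtain N :: nat where N: "(z - M) / (f1\<^sup>2 / (4 * a)) < real N" using reals_Archimedean2 by blast
    define T where "T = 2 * real N * pi"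
    \<comment> \<open>minimizes \<open>f1 * r + a * r\<^sup>2\<close>, the mean change of \<open>z\<close> per unit of time; the minimum is \<open>- f1\<^sup>2 / (4 * a)\<close>\<close>
    define r where "r = - f1 / (2 * a)"
    have trig: "sin T = 0" "cos T = 1" by (simp_all add: T_def)
    have "((\<lambda>s. f1 * (s - sin s)) has_vector_derivative f1 * (1 - cos s)) (at s within {0..T})" for s
      unfolding has_real_derivative_iff_has_vector_derivative[symmetric]
      by (auto intro!: derivative_eq_intros)
    then have int: "((\<lambda>s. f1 * (1 - cos s)) has_integral f1 * (T - sin T) - f1 * (0 - sin 0)) {0..T}"
      by (intro fundamental_theorem_of_calculus) (auto simp: T_def)
    have "oscillation_cross_term c1 b1 f1 d 1 (\<lambda>_. 0) (\<lambda>_. 0) = (\<lambda>s. f1 * (1 - cos s))"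
      using d by (simp add: oscillation_cross_term_def fun_eq_iff)
    then have drift: "integral {0..T} (oscillation_cross_term c1 b1 f1 d 1 (\<lambda>_. 0) (\<lambda>_. 0)) = f1 * T"
      using integral_unique[OF int] trig by simp
    have "?R (0, 0, 0, 0, z) (0, 0, 0, 0, exp (d * T) * (z
         + (r * integral {0..T} (oscillation_cross_term c1 b1 f1 d 1 (\<lambda>_. 0) (\<lambda>_. 0))
         + r\<^sup>2 * (T * (1\<^sup>2 + 3 * (d\<^sup>2 / 4 + b1 * c1)) / (4 * c1)))))"
      using reachable_loop[OF _ c(2) G, where ?r1.0 = r and ?r2.0 = 0 and ?c1.0 = c1
        and ?b1.0 = b1 and ?b2.0 = b2 and ?f1.0 = f1 and ?f2.0 = f2 and d = d and z = z and T = T and \<omega> = 1] trig c by (simp add: T_def)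
    moreover have "r * (f1 * T) + r\<^sup>2 * (T * (1\<^sup>2 + 3 * (d\<^sup>2 / 4 + b1 * c1)) / (4 * c1)) = - (f1\<^sup>2 / (4 * a)) * T"
    proof -
      have "T * (1\<^sup>2 + 3 * (d\<^sup>2 / 4 + b1 * c1)) / (4 * c1) = T * a" by (simp add: a_def d)
      then show ?thesis using \<open>0 < a\<close> by (simp add: r_def field_simps power2_eq_square)
    qed
    ultimately have "?R (0, 0, 0, 0, z) (0, 0, 0, 0, z - f1\<^sup>2 / (4 * a) * T)"
      unfolding drift by (simp add: d)
    moreover have "z - f1\<^sup>2 / (4 * a) * T \<le> M"
    proof -
      have "0 < f1\<^sup>2 / (4 * a)" using d \<open>0 < a\<close> by simp
      from N[unfolded pos_divide_less_eq[OF this]]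
      have "z - M < f1\<^sup>2 / (4 * a) * real N" by (simp only: mult.commute)
      also have "\<dots> \<le> f1\<^sup>2 / (4 * a) * T"
      proof (rule mult_left_mono)
        have "real N * 1 \<le> real N * (2 * pi)" using pi_gt3 by (intro mult_left_mono) auto
        then show "real N \<le> T" by (simp add: T_def mult.assoc mult.left_commute)
      qed (use \<open>0 < f1\<^sup>2 / (4 * a)\<close> in simp)
      finally show ?thesis by simp
    qed
    ultimately show ?thesis by blast
  qed
qed

section \<open>The criterion\<close>

lemma lie_bracket_swap_eq_0: "lie_bracket V W = 0 \<Longrightarrow> lie_bracket W V = 0"
  by (simp add: lie_bracket_def fun_eq_iff)

lemma symplectic_basis_swap:
  assumes "symplectic_basis B1 Y1 B2 Y2 Z"
  shows "symplectic_basis B2 Y2 B1 Y1 Z"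
proof -
  have "{B2, Y2, B1, Y1, Z} = {B1, Y1, B2, Y2, Z}" by auto
  then show ?thesis
    using assms unfolding symplectic_basis_def by (auto intro: lie_bracket_swap_eq_0)
qed

theorem theorem9:
  fixes \<X> B1 Y1 B2 Y2 Z :: vf
    and b d b' c' f f' :: real
  assumes "linear_system \<X> [B1, B2]"
    and "symplectic_basis B1 Y1 B2 Y2 Z"
    and "decoupled \<X> B1 Y1 B2 Y2 Z"
    and "matrix_in_basis (assoc_derivation \<X>) [B1, Y1, B2, Y2, Z]
           [[0, b, 0,  0,  0],
            [1, d, 0,  0,  0],
            [0, 0, 0,  b', 0],
            [0, 0, c', d,  0],
            [0, f, 0,  f', d]]"
    and "c' \<noteq> 0"
    and "rank_condition \<X> [B1, B2]"
    and "\<not> controllable_on (connected_lie_subgroup (span {B1, Y1, Z})) \<X> [B1]"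
    and "\<not> controllable_on (connected_lie_subgroup (span {B2, Y2, Z})) \<X> [B2]"
  shows "controllable_on (carrier Heis) \<X> [B1, B2] \<longleftrightarrow> c' < 0"
proof -
  have \<X>: "linear_vf \<X>" using assms(1) by (simp add: linear_system_def)
  have D: "assoc_derivation \<X> B1 = 1 *\<^sub>R Y1"
      "assoc_derivation \<X> Y1 = b *\<^sub>R B1 + d *\<^sub>R Y1 + f *\<^sub>R Z"
      "assoc_derivation \<X> B2 = c' *\<^sub>R Y2"
      "assoc_derivation \<X> Y2 = b' *\<^sub>R B2 + d *\<^sub>R Y2 + f' *\<^sub>R Z"
      "assoc_derivation \<X> Z = d *\<^sub>R Z"
  proof -
    have columns: "assoc_derivation \<X> ([B1, Y1, B2, Y2, Z] ! j) =
        (\<Sum>i<5. ([[0, b, 0, 0, 0], [1, d, 0, 0, 0], [0, 0, 0, b', 0], [0, 0, c', d, 0], [0, f, 0, f', d]] ! i ! j)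
          *\<^sub>R ([B1, Y1, B2, Y2, Z] ! i))" if "j < 5" for j
      using assms(4) that by (simp add: matrix_in_basis_def eval_nat_numeral)
    show "assoc_derivation \<X> B1 = 1 *\<^sub>R Y1"
      "assoc_derivation \<X> Y1 = b *\<^sub>R B1 + d *\<^sub>R Y1 + f *\<^sub>R Z"
      "assoc_derivation \<X> B2 = c' *\<^sub>R Y2"
      "assoc_derivation \<X> Y2 = b' *\<^sub>R B2 + d *\<^sub>R Y2 + f' *\<^sub>R Z"
      "assoc_derivation \<X> Z = d *\<^sub>R Z"
      using columns[of 0] columns[of 1] columns[of 2] columns[of 3] columns[of 4]
      by (simp_all add: eval_nat_numeral)
  qed
  note normal = controllable_normal_field[OF \<X> assms(2) D]
  note normal' = controllable_normal_field[OF \<X> symplectic_basis_swap[OF assms(2)] D(3,4,1,2,5)]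
  show ?thesis
  proof
    assume "c' < 0"
    then show "controllable_on (carrier Heis) \<X> [B1, B2]"
      unfolding normal(1) by (intro controllable_opposite_signs) auto
  next
    assume controllable: "controllable_on (carrier Heis) \<X> [B1, B2]"
    show "c' < 0"
    proof (rule ccontr)
      assume "\<not> c' < 0"
      then have "0 < c'" using assms(5) by simp
      \<comment> \<open>a block that violated one of these conditions could lower \<open>z\<close> by itself, making its subsystem controllable\<close>
      have "0 \<le> d\<^sup>2 / 4 + b * 1" "d = 0 \<longrightarrow> f = 0"
        using normal(2) controllable_first_factor[of 1 c' d b f] assms(5,7) by force+
      moreover have "0 \<le> d\<^sup>2 / 4 + b' * c'" "d = 0 \<longrightarrow> f' = 0"
        using normal'(2) controllable_first_factor[of c' 1 d b' f'] \<open>0 < c'\<close> assms(8) by force+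
      ultimately show False
        using not_controllable_normal_field[of 1 c' d b b' f f'] \<open>0 < c'\<close> controllable
        unfolding normal(1) by simp
    qed
  qed
qed

end
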